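(* Let $X$ be a real Banach space, let $q$ be a continuous quadratic form on $X$ and let $T\colon X\to X^*$ be the symmetric operator that generates $q$, i.e. $q(x)=\langle Tx,x\rangle$ for all $x\in X$. Then $q$ is delta-convex if and only if $T$ is a UMD-operator.
   Context: A function $q\colon X\to\mathbb{R}$ is a continuous quadratic form if there is a continuous bilinear form $b\colon X\times X\to\mathbb{R}$ with $q(x)=b(x,x)$ for all $x$. A bounded linear operator $T\colon X\to X^*$ is symmetric if $\langle Tx,y\rangle=\langle Ty,x\rangle$ for all $x,y$; each continuous quadratic form is generated by exactly one symmetric operator. A function on $X$ is delta-convex if it is the difference of two continuous convex functions on $X$. Walsh--Paley martingales: let $\Gamma=\{-1,1\}$ and $n\ge1$; $\Gamma^n$ carries the uniform probability measure, with expectation $\mathbb{E}f=2^{-n}\sum_{\eta\in\Gamma^n}f(\eta)$. For $0\le k\le n$ let $\Sigma_k=\{A\times\Gamma^{n-k}:A\subset\Gamma^k\}$ (so $\Sigma_k$-measurable functions depend only on the first $k$ coordinates). An $X$-valued Walsh--Paley martingale is a finite sequence $(f_0,\dots,f_n)$ of functions $\Gamma^n\to X$ with $f_k=\mathbb{E}(f_n|\Sigma_k)$ for $0\le k\le n$; its martingale differences are $df_k=f_k-f_{k-1}$, $1\le k\le n$. A linear operator $T\colon X\to Y$ between Banach spaces is a UMD-operator if there is a constant $C>0$ such that $\mathbb{E}\|\sum_{k=1}^n\varepsilon_k\,T\,df_k\|^2\le C\,\mathbb{E}\|f_n\|^2$ for every $X$-valued Walsh--Paley martingale $(f_0,\dots,f_n)$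 (of any finite length) and all numbers $\varepsilon_1,\dots,\varepsilon_n\in\{-1,1\}$. *)

theory Defs
  imports "HOL-Analysis.Analysis"
begin

definition continuous_quadratic_form :: "('a::real_normed_vector \<Rightarrow> real) \<Rightarrow> bool" where
  "continuous_quadratic_form q \<longleftrightarrow>
     (\<exists>b. bilinear b \<and> continuous_on UNIV (\<lambda>(x, y). b x y) \<and> (\<forall>x. q x = b x x))"

(* The dual space of 'a is rendered as the type of bounded linear functionals with operator norm. *)

definition symmetric_operator :: "('a::real_normed_vector \<Rightarrow>\<^sub>L ('a \<Rightarrow>\<^sub>L real)) \<Rightarrow> bool" where
  "symmetric_operator T \<longleftrightarrow>
     (\<forall>x y. blinfun_apply (blinfun_apply T x) y = blinfun_apply (blinfun_apply T y) x)"

definition delta_convex :: "('a::real_normed_vector \<Rightarrow> real) \<Rightarrow> bool" where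
  "delta_convex h \<longleftrightarrow>
     (\<exists>f g. convex_on UNIV f \<and> continuous_on UNIV f \<and>
            convex_on UNIV g \<and> continuous_on UNIV g \<and> (\<forall>x. h x = f x - g x))"

definition signs :: "real set" where
  "signs = {-1, 1}"

definition sign_cube :: "nat \<Rightarrow> (nat \<Rightarrow> real) set" where
  "sign_cube n = {1..n} \<rightarrow>\<^sub>E signs"

definition cube_expectation :: "nat \<Rightarrow> ((nat \<Rightarrow> real) \<Rightarrow> 'b::real_vector) \<Rightarrow> 'b" where
  "cube_expectation n f = (1 / 2 ^ n) *\<^sub>R (\<Sum>\<eta>\<in>sign_cube n. f \<eta>)"

(* For k \<le> n and A \<subseteq> sign_cube k, the cylinder A \<times> signs^(n - k) is the set of all points of
   sign_cube n whose restriction to the first k coordinates lies in A. *)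
definition cylinder_algebra :: "nat \<Rightarrow> nat \<Rightarrow> (nat \<Rightarrow> real) set set" where
  "cylinder_algebra n k =
     {{\<eta> \<in> sign_cube n. restrict \<eta> {1..k} \<in> A} | A. A \<subseteq> sign_cube k}"

(* The library's conditional expectation is restricted to real-valued functions; this is the
   defining property for vector-valued ones: g is a version of E(f | Sigma_k).  Since every atom
   of Sigma_k has positive probability, g is determined on the whole of sign_cube n. *)
definition is_cond_expectation ::
    "nat \<Rightarrow> nat \<Rightarrow> ((nat \<Rightarrow> real) \<Rightarrow> 'a::real_normed_vector) \<Rightarrow> ((nat \<Rightarrow> real) \<Rightarrow> 'a) \<Rightarrow> bool" where
  "is_cond_expectation n k f g \<longleftrightarrow>
     g \<in> borel_measurable (sigma (sign_cube n) (cylinder_algebra n k)) \<and>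
     (\<forall>A\<in>cylinder_algebra n k.
        cube_expectation n (\<lambda>\<eta>. indicator A \<eta> *\<^sub>R g \<eta>) =
        cube_expectation n (\<lambda>\<eta>. indicator A \<eta> *\<^sub>R f \<eta>))"

(* A martingale (f 0, ..., f n); the values f k for k > n and off sign_cube n are irrelevant. *)
definition walsh_paley_martingale ::
    "nat \<Rightarrow> (nat \<Rightarrow> (nat \<Rightarrow> real) \<Rightarrow> 'a::real_normed_vector) \<Rightarrow> bool" where
  "walsh_paley_martingale n f \<longleftrightarrow> (\<forall>k\<le>n. is_cond_expectation n k (f n) (f k))"

definition martingale_diff ::
    "(nat \<Rightarrow> (nat \<Rightarrow> real) \<Rightarrow> 'a::real_normed_vector) \<Rightarrow> nat \<Rightarrow> (nat \<Rightarrow> real) \<Rightarrow> 'a" where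
  "martingale_diff f k \<eta> = f k \<eta> - f (k - 1) \<eta>"

definition UMD_operator :: "('a::banach \<Rightarrow> 'b::banach) \<Rightarrow> bool" where
  "UMD_operator T \<longleftrightarrow> linear T \<and>
     (\<exists>C>0. \<forall>n\<ge>1. \<forall>f \<epsilon>.
        walsh_paley_martingale n f \<longrightarrow> (\<forall>k\<in>{1..n}. \<epsilon> k \<in> signs) \<longrightarrow>
        cube_expectation n
          (\<lambda>\<eta>. (norm (\<Sum>k = 1..n. \<epsilon> k *\<^sub>R T (martingale_diff f k \<eta>)))\<^sup>2)
        \<le> C * cube_expectation n (\<lambda>\<eta>. (norm (f n \<eta>))\<^sup>2))"

end

theory Submission
  imports Defs
begin

text \<open>
  Write \<^emph>\<open>form\<close> for the quadratic form generated by \<open>T\<close>. If \<open>form = f - g\<close> with \<open>f\<close>, \<open>g\<close>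
  convex, then \<open>p = f + g\<close> makes both \<open>p + form\<close> and \<open>p - form\<close> convex. By the parallelogram law this
  means \<open>p x + \<bar>form h\<bar> \<le> (p (x + h) + p (x - h)) / 2\<close> for all \<open>x\<close>, \<open>h\<close>. This inequality is one step of a
  martingale estimate: along a Walsh--Paley martingale, whose \<open>k\<close>-th difference only changes sign with
  the \<open>k\<close>-th coordinate, \<open>\<bar>form\<bar>\<close> of the difference has expectation at most the increment of \<open>E (p f\<^sub>k)\<close>.

  \<^bold>\<open>Delta-convex implies UMD.\<close> Summing the increments bounds \<open>\<Sum>\<^sub>k E \<bar>form df\<^sub>k\<bar>\<close> by \<open>E (p f\<^sub>n)\<close>, which is useful
  only if \<open>p\<close> grows quadratically. A majorant with this growth is obtained by gluing rescaled copies of a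
  normalised \<open>p\<close> along dyadic shells (lemma \<open>glued_convex_function\<close>); gluing is possible because a
  continuous function that is convex near every point is convex. The outcome is the square function
  estimate \<open>\<Sum>\<^sub>k E \<bar>form df\<^sub>k\<bar> \<le> C E \<bar>f\<^sub>n\<bar>\<^sup>2\<close> (lemma \<open>square_estimate_if_delta_convex\<close>). The martingale
  transform takes values in the dual space, so its norm is computed by testing it against a second
  martingale \<open>g\<close>; orthogonality of differences and polarization reduce the test to the square function
  estimate for \<open>f + g\<close> and \<open>f - g\<close> (lemma \<open>transform_bound_if_square_estimate\<close>).

  \<^bold>\<open>UMD implies delta-convex.\<close> The UMD inequality, tested against the martingale itself, gives
  \<open>\<Sum>\<^sub>k \<epsilon>\<^sub>k E (form df\<^sub>k) \<le> C E \<bar>f\<^sub>n\<bar>\<^sup>2\<close> for constant signs. Let \<open>V x\<close> be the infimum of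
  \<open>C E \<bar>f\<^sub>n\<bar>\<^sup>2 - \<Sum>\<^sub>k (-1) ^ (n - k) E (form df\<^sub>k)\<close> over a class of martingales that start at \<open>x\<close> and is
  closed under prefixing a first step to a pair of members. Then
  \<open>0 \<le> V x \<le> C \<bar>x\<bar>\<^sup>2\<close>. Starting with a step from \<open>x\<close> to \<open>x + h\<close> or \<open>x - h\<close>, whose sign in the alternating sum can
  be chosen at will by inserting a zero step, shows \<open>V x + \<bar>form h\<bar> \<le> (V (x + h) + V (x - h)) / 2\<close>. So
  \<open>V + form\<close> and \<open>V - form\<close> are midpoint convex and locally bounded, hence convex and continuous, and
  half their difference is \<open>form\<close> (lemma \<open>delta_convex_if_signed_sum_bound\<close>).
\<close>

section \<open>Convexity criteria\<close>

text \<open>Let \<open>M\<close> be the supremum of \<open>f\<close> minus a chord over the segment. Each point of the segment is the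
  midpoint of an endpoint, where this difference vanishes, and another point of the segment; so the
  difference is at most \<open>M / 2\<close> everywhere, and \<open>M \<le> 0\<close>. Boundedness serves to make \<open>M\<close> finite.\<close>

lemma convex_on_if_midpoint_convex:
  fixes f :: "'a::real_normed_vector \<Rightarrow> real"
  assumes mid: "\<And>x h. 2 * f x \<le> f (x + h) + f (x - h)"
    and bdd: "\<And>r. \<exists>B. \<forall>x. norm x \<le> r \<longrightarrow> f x \<le> B"
  shows "convex_on UNIV f"
proof (rule convex_onI)
  fix t :: real and x y :: 'a
  assume t: "0 < t" "t < 1"
  define z where "z s = (1 - s) *\<^sub>R x + s *\<^sub>R y" for s
  define g where "g s = f (z s) - ((1 - s) * f x + s * f y)" for s
  obtain B where B: "\<And>v. norm v \<le> norm x + norm y \<Longrightarrow> f v \<le> B"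
    using bdd by blast
  have g_bdd: "g s \<le> B + \<bar>f x\<bar> + \<bar>f y\<bar>" if s: "s \<in> {0..1}" for s
  proof -
    have "norm (z s) \<le> (1 - s) * norm x + s * norm y"
      unfolding z_def using s by (intro norm_triangle_le) simp
    also have "\<dots> \<le> 1 * norm x + 1 * norm y"
      using s by (intro add_mono mult_right_mono) auto
    finally have 1: "f (z s) \<le> B" by (intro B) simp
    have 2: "\<bar>(1 - s) * f x\<bar> \<le> \<bar>f x\<bar>" "\<bar>s * f y\<bar> \<le> \<bar>f y\<bar>"
      using s by (simp_all add: abs_mult mult_left_le_one_le)
    then show ?thesis using 1 unfolding g_def by linarith
  qed
  have bdd_g: "bdd_above (g ` {0..1})"
    by (intro bdd_aboveI2[where M = "B + \<bar>f x\<bar> + \<bar>f y\<bar>"]) (rule g_bdd)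
  define M where "M = (SUP s\<in>{0..1}. g s)"
  have le_M: "g s \<le> M" if "s \<in> {0..1}" for s
    unfolding M_def using that by (intro cSUP_upper bdd_g)
  have g_mid: "2 * g s \<le> g (s + d) + g (s - d)" for s d
  proof -
    have e: "z s + d *\<^sub>R (y - x) = z (s + d)" "z s - d *\<^sub>R (y - x) = z (s - d)"
      unfolding z_def by (simp_all add: algebra_simps)
    have "2 * f (z s) \<le> f (z (s + d)) + f (z (s - d))"
      using mid[of "z s" "d *\<^sub>R (y - x)"] unfolding e .
    then show ?thesis unfolding g_def by (simp add: algebra_simps)
  qed
  have g0: "g 0 = 0" "g 1 = 0" by (simp_all add: g_def z_def)
  have half: "g s \<le> M / 2" if s: "s \<in> {0..1}" for s
  proof (cases "s \<le> 1/2")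
    case True
    then show ?thesis using g_mid[of s s] g0 le_M[of "s + s"] s by simp
  next
    case False
    then show ?thesis using g_mid[of s "1 - s"] g0 le_M[of "s - (1 - s)"] s by simp
  qed
  have "M \<le> M / 2" unfolding M_def
    by (rule cSUP_least) (use half in \<open>auto simp: M_def\<close>)
  then have "g t \<le> 0" using le_M[of t] t by simp
  then show "f ((1 - t) *\<^sub>R x + t *\<^sub>R y) \<le> (1 - t) * f x + t * f y"
    by (simp add: g_def z_def)
qed simp

text \<open>At the leftmost maximum of \<open>f\<close> minus a chord, local convexity forces the maximal value at a
  point further to the left, unless this maximum is an endpoint, where the difference is zero.\<close>

lemma convex_on_if_locally_convex:
  fixes f :: "'a::real_normed_vector \<Rightarrow> real"
  assumes U: "convex U" and cont: "continuous_on U f"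
    and loc: "\<And>x. x \<in> U \<Longrightarrow> \<exists>e>0. convex_on (ball x e) f"
  shows "convex_on U f"
proof (rule convex_onI)
  fix t :: real and x y :: 'a
  assume t: "0 < t" "t < 1" and xy: "x \<in> U" "y \<in> U"
  define z where "z s = (1 - s) *\<^sub>R x + s *\<^sub>R y" for s
  define g where "g s = f (z s) - ((1 - s) * f x + s * f y)" for s
  have zU: "z s \<in> U" if "s \<in> {0..1}" for s
    unfolding z_def using that U xy by (intro convexD) auto
  have cont_z: "continuous_on {0..1} z"
    unfolding z_def by (intro continuous_intros)
  have "continuous_on {0..1} (f \<circ> z)"
    using cont_z cont zU by (intro continuous_on_compose) (auto intro: continuous_on_subset)
  then have cont_g: "continuous_on {0..1} g"
    unfolding g_def comp_def by (intro continuous_intros)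
  have g0: "g 0 = 0" "g 1 = 0" by (simp_all add: g_def z_def)
  obtain s1 where s1: "s1 \<in> {0..1}" "\<And>s. s \<in> {0..1} \<Longrightarrow> g s \<le> g s1"
    using continuous_attains_sup[OF _ _ cont_g] by force
  have "g s1 \<le> 0"
  proof (rule ccontr)
    assume pos: "\<not> g s1 \<le> 0"
    define S where "S = {s \<in> {0..1}. g s = g s1}"
    have "closed S" unfolding S_def
      using continuous_closed_preimage_constant[OF cont_g] by simp
    then have "compact S"
      by (intro compact_eq_bounded_closed[THEN iffD2] conjI)
        (auto intro: bounded_subset[OF bounded_closed_interval[of 0 1]] simp: S_def)
    moreover have "S \<noteq> {}" using s1 by (auto simp: S_def)
    ultimately obtain s0 where s0: "s0 \<in> S" "\<And>s. s \<in> S \<Longrightarrow> s0 \<le> s"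
      using compact_attains_inf[of S] by blast
    have s0_range: "0 < s0" "s0 < 1" and s0_eq: "g s0 = g s1"
      using s0(1) pos g0 unfolding S_def by (auto simp: less_le)
    obtain e where e: "e > 0" "convex_on (ball (z s0) e) f"
      using loc zU s0_range by (metis atLeastAtMost_iff less_imp_le)
    define d where "d = Min {s0, 1 - s0, e / (2 * (1 + norm (y - x)))}"
    have d: "d > 0" "d \<le> s0" "d \<le> 1 - s0" "d \<le> e / (2 * (1 + norm (y - x)))"
      using s0_range e by (auto simp: d_def add_pos_nonneg)
    have "d * norm (y - x) \<le> d * (1 + norm (y - x))" using d by simp
    also have "\<dots> \<le> e / 2"
      using d(4) by (simp add: field_simps add_pos_nonneg)
    finally have small: "d * norm (y - x) < e" using e by simp
    have zd: "z (s0 + d) = z s0 + d *\<^sub>R (y - x)" "z (s0 - d) = z s0 - d *\<^sub>R (y - x)"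
      unfolding z_def by (simp_all add: algebra_simps)
    have "f ((1 - 1/2) *\<^sub>R z (s0 + d) + (1/2) *\<^sub>R z (s0 - d))
        \<le> (1 - 1/2) * f (z (s0 + d)) + 1/2 * f (z (s0 - d))"
      using small d by (intro convex_onD[OF e(2)]) (auto simp: zd dist_norm)
    also have "(1 - 1/2) *\<^sub>R z (s0 + d) + (1/2) *\<^sub>R z (s0 - d) = z s0"
      unfolding zd by (simp add: algebra_simps flip: scaleR_add_left)
    finally have "2 * g s0 \<le> g (s0 + d) + g (s0 - d)"
      unfolding g_def by (simp add: algebra_simps)
    moreover have "g (s0 + d) \<le> g s1" "g (s0 - d) \<le> g s1"
      using d s0_range by (auto intro!: s1(2))
    ultimately have "g (s0 - d) = g s1" using s0_eq by linarith
    then have "s0 - d \<in> S" using d s0_range by (auto simp: S_def)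
    then show False using s0(2) d(1) by fastforce
  qed
  then have "g t \<le> 0" using s1(2)[of t] t by simp
  then show "f ((1 - t) *\<^sub>R x + t *\<^sub>R y) \<le> (1 - t) * f x + t * f y"
    by (simp add: g_def z_def)
qed (rule U)

lemma continuous_on_if_convex_bounded_on_balls:
  fixes f :: "'a::real_normed_vector \<Rightarrow> real"
  assumes "convex_on UNIV f" and bdd: "\<And>r. \<exists>B. \<forall>x. norm x \<le> r \<longrightarrow> \<bar>f x\<bar> \<le> B"
  shows "continuous_on UNIV f"
proof -
  have "isCont f x" for x
  proof -
    obtain B where B: "\<And>y. norm y \<le> norm x + 1 \<Longrightarrow> \<bar>f y\<bar> \<le> B" using bdd by blast
    have "continuous_on (ball 0 (norm x + 1)) f"
      by (rule convex_on_bounded_continuous[where b = B])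
        (use assms(1) B in \<open>auto intro: convex_on_subset\<close>)
    then show ?thesis
      by (subst (asm) continuous_on_eq_continuous_at) (auto simp: add_pos_nonneg)
  qed
  then show ?thesis by (simp add: continuous_at_imp_continuous_on)
qed

lemma convex_on_max:
  fixes f g :: "'a::real_vector \<Rightarrow> real"
  assumes "convex_on S f" "convex_on S g"
  shows "convex_on S (\<lambda>x. max (f x) (g x))"
proof (rule convex_onI)
  fix t :: real and x y
  assume a: "0 < t" "t < 1" "x \<in> S" "y \<in> S"
  have "f ((1 - t) *\<^sub>R x + t *\<^sub>R y) \<le> (1 - t) * f x + t * f y"
    "g ((1 - t) *\<^sub>R x + t *\<^sub>R y) \<le> (1 - t) * g x + t * g y"
    using a assms by (auto intro!: convex_onD)
  moreover have "(1 - t) * f x \<le> (1 - t) * max (f x) (g x)" "(1 - t) * g x \<le> (1 - t) * max (f x) (g x)"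
    "t * f y \<le> t * max (f y) (g y)" "t * g y \<le> t * max (f y) (g y)"
    using a by (auto intro!: mult_left_mono)
  ultimately show "max (f ((1 - t) *\<^sub>R x + t *\<^sub>R y)) (g ((1 - t) *\<^sub>R x + t *\<^sub>R y))
      \<le> (1 - t) * max (f x) (g x) + t * max (f y) (g y)"
    by linarith
next
  show "convex S" using assms(1) by (rule convex_on_imp_convex)
qed

lemma convex_on_transfer:
  assumes "convex_on S f" "\<And>x. x \<in> S \<Longrightarrow> f x = g x"
  shows "convex_on S g"
proof (rule convex_onI)
  show S: "convex S" using assms(1) by (rule convex_on_imp_convex)
  fix t :: real and x y
  assume a: "0 < t" "t < 1" "x \<in> S" "y \<in> S"
  then have "(1 - t) *\<^sub>R x + t *\<^sub>R y \<in> S" by (intro convexD[OF S]) auto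
  then show "g ((1 - t) *\<^sub>R x + t *\<^sub>R y) \<le> (1 - t) * g x + t * g y"
    using convex_onD[OF assms(1), of t x y] a assms(2) by simp
qed

lemma convex_on_comp_scaleR:
  assumes "convex_on UNIV f"
  shows "convex_on UNIV (\<lambda>x. f (c *\<^sub>R x))"
proof (rule convex_onI)
  fix t :: real and x y
  assume "0 < t" "t < 1"
  then show "f (c *\<^sub>R ((1 - t) *\<^sub>R x + t *\<^sub>R y)) \<le> (1 - t) * f (c *\<^sub>R x) + t * f (c *\<^sub>R y)"
    using convex_onD[OF assms, of t "c *\<^sub>R x" "c *\<^sub>R y"] by (simp add: algebra_simps)
qed simp

lemma convex_on_norm_UNIV: "convex_on UNIV (norm :: 'a::real_normed_vector \<Rightarrow> real)"
  using convex_on_dist[of "UNIV::'a set" 0] by simp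

section \<open>A convex majorant of quadratic growth\<close>

text \<open>The function \<open>p\<close> may grow arbitrarily fast. As \<open>Q\<close> is 2-homogeneous, the rescaled functions
  \<open>4 ^ n * p (x / 2 ^ n)\<close> are convex after adding or subtracting \<open>Q\<close> too, and at most
  \<open>2 ^ n * norm x\<close> on the ball of radius \<open>2 ^ n\<close>. The convex correction \<open>5 * 2 ^ n * norm x - 4 ^ n\<close> keeps
  them below \<open>9 * (norm x)\<^sup>2\<close> there, and makes piece \<open>n + 1\<close> dominate everything built before it on the
  shell between the radii \<open>4/5 * 2 ^ n\<close> and \<open>2 ^ n\<close>. Hence one may take the maximum of the old function
  and piece \<open>n + 1\<close> inside radius \<open>2 ^ n\<close> and piece \<open>n + 1\<close> alone outside: near each point the result is
  either a maximum of two admissible functions or a single one. The bound \<open>5 * 2 ^ N * norm x\<close> is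
  the part of the induction invariant that gives the domination. The bounds \<open>-1\<close> and \<open>9 * (norm x)\<^sup>2\<close>
  do not depend on \<open>N\<close>, so a family of functions on growing balls is as good as one on the whole space.\<close>

lemma glued_convex_function:
  fixes p Q :: "'a::real_normed_vector \<Rightarrow> real"
  assumes cont_p: "continuous_on UNIV p" and cont_Q: "continuous_on UNIV Q"
    and Q_scale: "\<And>c x. Q (c *\<^sub>R x) = c\<^sup>2 * Q x"
    and plus: "convex_on UNIV (\<lambda>x. p x + Q x)" and minus: "convex_on UNIV (\<lambda>x. p x - Q x)"
    and p_nonneg: "\<And>x. 0 \<le> p x" and p_le: "\<And>x. norm x \<le> 1 \<Longrightarrow> p x \<le> norm x"
  shows "\<exists>P. continuous_on (ball 0 (2 ^ N)) P
    \<and> convex_on (ball 0 (2 ^ N)) (\<lambda>x. P x + Q x) \<and> convex_on (ball 0 (2 ^ N)) (\<lambda>x. P x - Q x)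
    \<and> (\<forall>x\<in>ball 0 (2 ^ N). -1 \<le> P x \<and> P x \<le> 9 * (norm x)\<^sup>2 \<and> P x \<le> 5 * 2 ^ N * norm x)"
proof -
  define piece where "piece n x = 4 ^ n * p ((1 / 2 ^ n) *\<^sub>R x) + 5 * 2 ^ n * norm x - 4 ^ n" for n :: nat and x
  have four: "(4::real) ^ n = 2 ^ n * 2 ^ n" for n by (simp flip: power_mult_distrib)
  have cont_piece: "continuous_on S (piece n)" for S n
    unfolding piece_def
    by (intro continuous_intros continuous_on_compose2[OF cont_p]) auto
  have Q_piece: "4 ^ n * Q ((1 / 2 ^ n) *\<^sub>R x) = Q x" for n x
    unfolding Q_scale by (simp add: four power2_eq_square)
  have convex_piece: "convex_on UNIV (\<lambda>x. piece n x + \<sigma> * Q x)"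
    if h: "convex_on UNIV (\<lambda>x. p x + \<sigma> * Q x)" for n \<sigma>
  proof -
    have "convex_on UNIV (\<lambda>x. 4 ^ n * (p ((1 / 2 ^ n) *\<^sub>R x) + \<sigma> * Q ((1 / 2 ^ n) *\<^sub>R x))
        + (5 * 2 ^ n) * norm x + (- (4 ^ n)))"
      by (intro convex_on_add convex_on_cmul convex_on_norm_UNIV convex_on_comp_scaleR[OF h])
        (simp_all add: convex_on_const)
    moreover have "4 ^ n * (p ((1 / 2 ^ n) *\<^sub>R x) + \<sigma> * Q ((1 / 2 ^ n) *\<^sub>R x))
        + (5 * 2 ^ n) * norm x + (- (4 ^ n)) = piece n x + \<sigma> * Q x" for x
      unfolding piece_def distrib_left mult.left_commute[of _ \<sigma>] Q_piece by simp
    ultimately show ?thesis by simp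
  qed
  have piece_plus: "convex_on UNIV (\<lambda>x. piece n x + Q x)"
    and piece_minus: "convex_on UNIV (\<lambda>x. piece n x - Q x)" for n
    using convex_piece[of 1 n] convex_piece[of "-1" n] plus minus by simp_all
  have piece_lower: "piece n x \<ge> 5 * 2 ^ n * norm x - 4 ^ n" for n x
    unfolding piece_def using p_nonneg by simp
  have piece_upper: "piece n x \<le> 6 * 2 ^ n * norm x - 4 ^ n" if "norm x \<le> 2 ^ n" for n x
  proof -
    have "p ((1 / 2 ^ n) *\<^sub>R x) \<le> (1 / 2 ^ n) * norm x"
      using that by (intro order_trans[OF p_le]) (simp_all add: field_simps)
    then have "4 ^ n * p ((1 / 2 ^ n) *\<^sub>R x) \<le> 4 ^ n * ((1 / 2 ^ n) * norm x)"
      by (intro mult_left_mono) auto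
    then show ?thesis unfolding piece_def by (simp add: four)
  qed
  \<comment> \<open>complete the square: \<open>6 t r - t\<^sup>2 \<le> 9 r\<^sup>2\<close> with \<open>t = 2 ^ n\<close>\<close>
  have piece_quadratic: "piece n x \<le> 9 * (norm x)\<^sup>2" if "norm x \<le> 2 ^ n" for n x
  proof -
    have "0 \<le> (3 * norm x - 2 ^ n)\<^sup>2" by simp
    then show ?thesis using piece_upper[OF that]
      by (simp add: power2_eq_square algebra_simps four)
  qed
  have piece_linear: "piece n x \<le> 5 * 2 ^ n * norm x" if "norm x \<le> 2 ^ n" for n x
  proof -
    have "2 ^ n * norm x \<le> 4 ^ n" using that unfolding four by (intro mult_left_mono) auto
    then show ?thesis using piece_upper[OF that] by linarith
  qed
  show ?thesis
  proof (induction N)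
    case 0
    show ?case
    proof (intro exI[of _ "piece 0"] conjI ballI)
      fix x :: 'a assume "x \<in> ball 0 (2 ^ 0)"
      then have "norm x \<le> 2 ^ 0" by simp
      then show "piece 0 x \<le> 9 * (norm x)\<^sup>2" "piece 0 x \<le> 5 * 2 ^ 0 * norm x"
        by (rule piece_quadratic, rule piece_linear)
      show "-1 \<le> piece 0 x" using piece_lower[of 0 x] by (simp, smt (verit) norm_ge_zero)
    qed (auto intro!: cont_piece convex_on_subset[OF piece_plus] convex_on_subset[OF piece_minus])
  next
    case (Suc N)
    define R :: real where "R = 2 ^ N"
    have R: "R > 0" "2 ^ Suc N = 2 * R" "4 ^ Suc N = 4 * R * R" by (simp_all add: R_def four)
    obtain P where cont_P: "continuous_on (ball 0 R) P"
      and P_plus: "convex_on (ball 0 R) (\<lambda>x. P x + Q x)"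
      and P_minus: "convex_on (ball 0 R) (\<lambda>x. P x - Q x)"
      and P_bounds: "\<And>x. norm x < R \<Longrightarrow> -1 \<le> P x \<and> P x \<le> 9 * (norm x)\<^sup>2 \<and> P x \<le> 5 * R * norm x"
      using Suc.IH unfolding R_def by auto
    define p' where "p' = piece (Suc N)"
    define P' where "P' x = (if norm x < R then max (P x) (p' x) else p' x)" for x
    have p'_lower: "p' x \<ge> 10 * R * norm x - 4 * R * R" for x
      using piece_lower[of "Suc N" x] unfolding p'_def R by simp
    have outer: "P' x = p' x" if "4 / 5 * R < norm x" for x
    proof (cases "norm x < R")
      case True
      have "4 * R * R \<le> 5 * R * norm x" using that R(1) by simp
      then have "P x \<le> p' x" using P_bounds[OF True] p'_lower[of x] by linarith
      then show ?thesis by (simp add: P'_def)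
    qed (simp add: P'_def)
    let ?V = "{x::'a. 4 / 5 * R < norm x}"
    have cover: "x \<in> ball 0 R \<or> x \<in> ?V" for x :: 'a using R(1) by auto
    have open_V: "open ?V" by (intro open_Collect_less continuous_intros)
    have "continuous_on (ball 0 R) P'"
      by (subst continuous_on_cong[OF refl, of _ _ "\<lambda>x. max (P x) (p' x)"])
        (auto simp: P'_def p'_def intro!: continuous_intros cont_P cont_piece)
    moreover have "continuous_on ?V P'"
      by (subst continuous_on_cong[OF refl, of _ _ p']) (auto simp: outer p'_def intro!: cont_piece)
    ultimately have "continuous_on (ball 0 R \<union> ?V) P'"
      using open_V by (intro continuous_on_open_Un) auto
    then have cont_P': "continuous_on S P'" for S
      by (rule continuous_on_subset) (use cover in blast)
    have loc: "convex_on (ball 0 (2 * R)) (\<lambda>x. P' x + \<sigma> * Q x)"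
      if P_conv: "convex_on (ball 0 R) (\<lambda>x. P x + \<sigma> * Q x)"
        and p_conv: "convex_on UNIV (\<lambda>x. p' x + \<sigma> * Q x)" for \<sigma>
    proof (rule convex_on_if_locally_convex)
      show "continuous_on (ball 0 (2 * R)) (\<lambda>x. P' x + \<sigma> * Q x)"
        by (intro continuous_intros cont_P' continuous_on_subset[OF cont_Q]) auto
    next
      fix x :: 'a
      consider "x \<in> ball 0 R" | "x \<in> ?V" using cover by blast
      then show "\<exists>e>0. convex_on (ball x e) (\<lambda>x. P' x + \<sigma> * Q x)"
      proof cases
        case 1
        then obtain e where e: "e > 0" "ball x e \<subseteq> ball 0 R"
          using open_ball openE by blast
        have "convex_on (ball x e) (\<lambda>x. max (P x + \<sigma> * Q x) (p' x + \<sigma> * Q x))"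
          using e P_conv p_conv by (intro convex_on_max) (auto intro: convex_on_subset)
        then have "convex_on (ball x e) (\<lambda>x. P' x + \<sigma> * Q x)"
          by (rule convex_on_transfer)
            (use e in \<open>auto simp: P'_def\<close>)
        then show ?thesis using e by blast
      next
        case 2
        then obtain e where e: "e > 0" "ball x e \<subseteq> ?V"
          using open_V openE by blast
        have "convex_on (ball x e) (\<lambda>x. p' x + \<sigma> * Q x)"
          using p_conv by (auto intro: convex_on_subset)
        then have "convex_on (ball x e) (\<lambda>x. P' x + \<sigma> * Q x)"
          by (rule convex_on_transfer)
            (use e outer in \<open>auto simp: subset_iff\<close>)
        then show ?thesis using e by blast
      qed
    qed simp
    show ?case unfolding R
    proof (intro exI[of _ P'] conjI ballI)
      show "continuous_on (ball 0 (2 * R)) P'" by (rule cont_P')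
      show "convex_on (ball 0 (2 * R)) (\<lambda>x. P' x + Q x)"
        "convex_on (ball 0 (2 * R)) (\<lambda>x. P' x - Q x)"
        using loc[of 1] loc[of "-1"] P_plus P_minus piece_plus piece_minus
        by (simp_all add: p'_def)
      fix x :: 'a assume "x \<in> ball 0 (2 * R)"
      then have x: "norm x \<le> 2 ^ Suc N" by (simp add: R_def)
      have "5 * R * norm x \<le> 5 * (2 * R) * norm x" using R(1) by (intro mult_right_mono) auto
      then show "P' x \<le> 5 * (2 * R) * norm x" "P' x \<le> 9 * (norm x)\<^sup>2"
        using P_bounds[of x] piece_linear[OF x] piece_quadratic[OF x]
        unfolding P'_def p'_def R(2) by auto
      show "-1 \<le> P' x"
      proof (cases "norm x < R")
        case False
        then have "R * R \<le> R * norm x" using R(1) by simp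
        moreover have "0 \<le> R * R" using R(1) by simp
        ultimately have "0 \<le> p' x" using p'_lower[of x] by linarith
        then show ?thesis using False by (simp add: P'_def)
      qed (use P_bounds in \<open>auto simp: P'_def intro: max.coboundedI1\<close>)
    qed
  qed
qed

section \<open>Walsh--Paley martingales and coordinate flips\<close>

lemma finite_sign_cube [simp]: "finite (sign_cube n)"
  unfolding sign_cube_def signs_def by (intro finite_PiE) auto

lemma card_sign_cube: "card (sign_cube n) = 2 ^ n"
  by (simp add: sign_cube_def signs_def card_PiE numeral_2_eq_2)

lemma sign_cube_apply: "\<eta> \<in> sign_cube n \<Longrightarrow> i \<in> {1..n} \<Longrightarrow> \<eta> i = -1 \<or> \<eta> i = 1"
  by (auto simp: sign_cube_def signs_def PiE_def Pi_def)

definition flip :: "nat \<Rightarrow> (nat \<Rightarrow> real) \<Rightarrow> nat \<Rightarrow> real" where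
  "flip j \<eta> = \<eta>(j := - \<eta> j)"

lemma flip_in_sign_cube: "j \<in> {1..n} \<Longrightarrow> \<eta> \<in> sign_cube n \<Longrightarrow> flip j \<eta> \<in> sign_cube n"
  by (auto simp: sign_cube_def signs_def flip_def PiE_def Pi_def extensional_def)

lemma flip_flip [simp]: "flip j (flip j \<eta>) = \<eta>"
  by (simp add: flip_def)

lemma flip_same: "flip j \<eta> j = - \<eta> j" and flip_other: "i \<noteq> j \<Longrightarrow> flip j \<eta> i = \<eta> i"
  by (simp_all add: flip_def)

subsection \<open>Expectation on the cube\<close>

lemma cube_expectation_cong:
  "(\<And>\<eta>. \<eta> \<in> sign_cube n \<Longrightarrow> f \<eta> = g \<eta>) \<Longrightarrow> cube_expectation n f = cube_expectation n g"
  by (simp add: cube_expectation_def)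

lemma cube_expectation_add:
  "cube_expectation n (\<lambda>\<eta>. f \<eta> + g \<eta>) = cube_expectation n f + cube_expectation n g"
  by (simp add: cube_expectation_def sum.distrib scaleR_add_right)

lemma cube_expectation_diff:
  "cube_expectation n (\<lambda>\<eta>. f \<eta> - g \<eta>) = cube_expectation n f - cube_expectation n g"
  by (simp add: cube_expectation_def sum_subtractf scaleR_diff_right)

lemma cube_expectation_cmult:
  "cube_expectation n (\<lambda>\<eta>. c * f \<eta> :: real) = c * cube_expectation n f"
  by (simp add: cube_expectation_def sum_distrib_left[symmetric])

lemma cube_expectation_sum:
  "cube_expectation n (\<lambda>\<eta>. \<Sum>k\<in>K. f k \<eta>) = (\<Sum>k\<in>K. cube_expectation n (f k))"
  unfolding cube_expectation_def by (subst sum.swap) (simp add: scaleR_sum_right)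

lemma cube_expectation_const: "cube_expectation n (\<lambda>\<eta>. c) = (c :: 'b::real_vector)"
  by (simp add: cube_expectation_def sum_constant_scaleR card_sign_cube)

lemma cube_expectation_mono:
  "(\<And>\<eta>. \<eta> \<in> sign_cube n \<Longrightarrow> f \<eta> \<le> g \<eta>)
    \<Longrightarrow> cube_expectation n f \<le> (cube_expectation n g :: real)"
  unfolding cube_expectation_def by (auto intro!: divide_right_mono sum_mono)

lemma cube_expectation_flip:
  assumes "j \<in> {1..n}"
  shows "cube_expectation n (\<lambda>\<eta>. f (flip j \<eta>)) = cube_expectation n f"
  unfolding cube_expectation_def
  by (rule arg_cong[where f = "scaleR _"],
      rule sum.reindex_bij_witness[where i = "flip j" and j = "flip j"])
    (use assms flip_in_sign_cube in auto)

lemma cube_expectation_odd: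
  fixes f :: "(nat \<Rightarrow> real) \<Rightarrow> 'b::real_vector"
  assumes "j \<in> {1..n}" and "\<And>\<eta>. \<eta> \<in> sign_cube n \<Longrightarrow> f (flip j \<eta>) = - f \<eta>"
  shows "cube_expectation n f = 0"
proof -
  have "cube_expectation n f = cube_expectation n (\<lambda>\<eta>. - f \<eta>)"
    unfolding cube_expectation_flip[OF assms(1), of f, symmetric]
    by (rule cube_expectation_cong) (rule assms(2))
  also have "\<dots> = - cube_expectation n f"
    by (simp add: cube_expectation_def sum_negf)
  finally show ?thesis by (simp add: eq_neg_iff_add_eq_0 flip: scaleR_2)
qed

subsection \<open>Dependence on initial coordinates\<close>

definition depends_on_first :: "nat \<Rightarrow> nat \<Rightarrow> ((nat \<Rightarrow> real) \<Rightarrow> 'b) \<Rightarrow> bool" where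
  "depends_on_first n k g \<longleftrightarrow>
     (\<forall>\<eta>\<in>sign_cube n. \<forall>\<eta>'\<in>sign_cube n. (\<forall>i\<in>{1..k}. \<eta> i = \<eta>' i) \<longrightarrow> g \<eta> = g \<eta>')"

lemma depends_on_firstI:
  "(\<And>\<eta> \<eta>'. \<eta> \<in> sign_cube n \<Longrightarrow> \<eta>' \<in> sign_cube n \<Longrightarrow> (\<And>i. i \<in> {1..k} \<Longrightarrow> \<eta> i = \<eta>' i) \<Longrightarrow> g \<eta> = g \<eta>')
    \<Longrightarrow> depends_on_first n k g"
  unfolding depends_on_first_def by blast

lemma depends_on_firstD:
  "depends_on_first n k g \<Longrightarrow> \<eta> \<in> sign_cube n \<Longrightarrow> \<eta>' \<in> sign_cube n
    \<Longrightarrow> (\<And>i. i \<in> {1..k} \<Longrightarrow> \<eta> i = \<eta>' i) \<Longrightarrow> g \<eta> = g \<eta>'"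
  unfolding depends_on_first_def by blast

lemma depends_on_first_mono:
  "depends_on_first n k g \<Longrightarrow> k \<le> l \<Longrightarrow> depends_on_first n l g"
  unfolding depends_on_first_def by (metis atLeastAtMost_iff order_trans)

lemma depends_on_first_flip:
  "depends_on_first n k g \<Longrightarrow> k < j \<Longrightarrow> j \<le> n \<Longrightarrow> \<eta> \<in> sign_cube n \<Longrightarrow> g (flip j \<eta>) = g \<eta>"
  by (rule depends_on_firstD[of n k g]) (auto simp: flip_in_sign_cube flip_other)

lemma depends_on_first_comp: "depends_on_first n k g \<Longrightarrow> depends_on_first n k (\<lambda>\<eta>. h (g \<eta>))"
  unfolding depends_on_first_def by metis

text \<open>Averaging over the last coordinate removes the dependence on it, because two points that
  agree before that coordinate agree on it up to a flip.\<close>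

lemma depends_on_first_average:
  fixes g :: "(nat \<Rightarrow> real) \<Rightarrow> 'b::real_vector"
  assumes "depends_on_first n k g" and k: "k \<in> {1..n}"
  shows "depends_on_first n (k - 1) (\<lambda>\<eta>. g \<eta> + g (flip k \<eta>))"
proof (rule depends_on_firstI)
  fix \<eta> \<eta>'
  assume cube: "\<eta> \<in> sign_cube n" "\<eta>' \<in> sign_cube n"
    and agree: "\<And>i. i \<in> {1..k - 1} \<Longrightarrow> \<eta> i = \<eta>' i"
  have fcube: "flip k \<eta> \<in> sign_cube n" "flip k \<eta>' \<in> sign_cube n"
    using cube k flip_in_sign_cube by auto
  have range: "i = k \<or> i \<in> {1..k - 1}" if "i \<in> {1..k}" for i using that by auto
  have other: "i \<noteq> k" if "i \<in> {1..k - 1}" for i using that k by auto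
  show "g \<eta> + g (flip k \<eta>) = g \<eta>' + g (flip k \<eta>')"
  proof (cases "\<eta> k = \<eta>' k")
    case True
    have "g \<eta> = g \<eta>'"
      by (rule depends_on_firstD[OF assms(1) cube]) (use True agree range in blast)
    moreover have "g (flip k \<eta>) = g (flip k \<eta>')"
    proof (rule depends_on_firstD[OF assms(1) fcube])
      fix i assume "i \<in> {1..k}"
      then show "flip k \<eta> i = flip k \<eta>' i"
        using True agree range[of i] by (auto simp: flip_def)
    qed
    ultimately show ?thesis by simp
  next
    case False
    then have opp: "\<eta>' k = - \<eta> k"
      using sign_cube_apply[OF cube(1) k] sign_cube_apply[OF cube(2) k] by auto
    have "g \<eta> = g (flip k \<eta>')"
    proof (rule depends_on_firstD[OF assms(1) cube(1) fcube(2)])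
      fix i assume "i \<in> {1..k}"
      then show "\<eta> i = flip k \<eta>' i"
        using opp agree range[of i] by (auto simp: flip_def)
    qed
    moreover have "g (flip k \<eta>) = g \<eta>'"
    proof (rule depends_on_firstD[OF assms(1) fcube(1) cube(2)])
      fix i assume "i \<in> {1..k}"
      then show "flip k \<eta> i = \<eta>' i"
        using opp agree range[of i] by (auto simp: flip_def)
    qed
    ultimately show ?thesis by simp
  qed
qed

lemma restrict_in_sign_cube: "k \<le> n \<Longrightarrow> \<eta> \<in> sign_cube n \<Longrightarrow> restrict \<eta> {1..k} \<in> sign_cube k"
  by (auto simp: sign_cube_def PiE_def Pi_def)

lemma restrict_eq_iff_agree: "restrict \<eta> {1..k} = restrict \<eta>' {1..k} \<longleftrightarrow> (\<forall>i\<in>{1..k}. \<eta> i = \<eta>' i)"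
  by (auto simp: fun_eq_iff restrict_def)

text \<open>A form of membership in \<open>\<Sigma>\<^sub>k\<close> that turns measurability, closure under complements and unions, and
  monotonicity in \<open>k\<close> into statements about points that agree in the first coordinates.\<close>

lemma cylinder_algebra_iff:
  assumes "k \<le> n"
  shows "B \<in> cylinder_algebra n k \<longleftrightarrow> B \<subseteq> sign_cube n \<and> depends_on_first n k (\<lambda>\<eta>. \<eta> \<in> B)"
proof
  assume "B \<in> cylinder_algebra n k"
  then obtain A where A: "B = {\<eta> \<in> sign_cube n. restrict \<eta> {1..k} \<in> A}"
    unfolding cylinder_algebra_def by blast
  have "depends_on_first n k (\<lambda>\<eta>. \<eta> \<in> B)"
  proof (rule depends_on_firstI)
    fix \<eta> \<eta>' assume "\<eta> \<in> sign_cube n" "\<eta>' \<in> sign_cube n" "\<And>i. i \<in> {1..k} \<Longrightarrow> \<eta> i = \<eta>' i"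
    then show "(\<eta> \<in> B) = (\<eta>' \<in> B)"
      unfolding A using restrict_eq_iff_agree[of \<eta> k \<eta>'] by auto
  qed
  then show "B \<subseteq> sign_cube n \<and> depends_on_first n k (\<lambda>\<eta>. \<eta> \<in> B)" using A by auto
next
  assume B: "B \<subseteq> sign_cube n \<and> depends_on_first n k (\<lambda>\<eta>. \<eta> \<in> B)"
  have "B = {\<eta> \<in> sign_cube n. restrict \<eta> {1..k} \<in> (\<lambda>\<eta>. restrict \<eta> {1..k}) ` B}"
  proof (intro set_eqI iffI)
    fix \<eta> assume "\<eta> \<in> {\<eta> \<in> sign_cube n. restrict \<eta> {1..k} \<in> (\<lambda>\<eta>. restrict \<eta> {1..k}) ` B}"
    then obtain \<zeta> where z: "\<eta> \<in> sign_cube n" "\<zeta> \<in> B" "\<forall>i\<in>{1..k}. \<eta> i = \<zeta> i"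
      using restrict_eq_iff_agree by blast
    then have "(\<eta> \<in> B) = (\<zeta> \<in> B)"
      using B by (intro depends_on_firstD[of n k "\<lambda>\<eta>. \<eta> \<in> B"]) auto
    then show "\<eta> \<in> B" using z by simp
  qed (use B in auto)
  moreover have "(\<lambda>\<eta>. restrict \<eta> {1..k}) ` B \<subseteq> sign_cube k"
    using B restrict_in_sign_cube[OF assms] by blast
  ultimately show "B \<in> cylinder_algebra n k" unfolding cylinder_algebra_def by blast
qed

lemma sigma_sets_cylinder_algebra:
  assumes "k \<le> n" "B \<in> sigma_sets (sign_cube n) (cylinder_algebra n k)"
  shows "depends_on_first n k (\<lambda>\<eta>. \<eta> \<in> B)"
  using assms(2)
proof induction
  case (Basic a)
  then show ?case using cylinder_algebra_iff[OF assms(1)] by blast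
next
  case Empty
  then show ?case by (simp add: depends_on_first_def)
next
  case (Compl a)
  then show ?case unfolding depends_on_first_def by blast
next
  case (Union a)
  then show ?case unfolding depends_on_first_def by blast
qed

lemma measurable_cylinder_algebra_iff:
  fixes g :: "(nat \<Rightarrow> real) \<Rightarrow> 'a::real_normed_vector"
  assumes "k \<le> n"
  shows "g \<in> borel_measurable (sigma (sign_cube n) (cylinder_algebra n k)) \<longleftrightarrow> depends_on_first n k g"
proof -
  have sub: "cylinder_algebra n k \<subseteq> Pow (sign_cube n)"
    unfolding cylinder_algebra_def by auto
  let ?M = "sigma (sign_cube n) (cylinder_algebra n k)"
  show ?thesis
  proof
    assume g: "g \<in> borel_measurable ?M"
    show "depends_on_first n k g"
    proof (rule depends_on_firstI)
      fix \<eta> \<eta>'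
      assume a: "\<eta> \<in> sign_cube n" "\<eta>' \<in> sign_cube n" "\<And>i. i \<in> {1..k} \<Longrightarrow> \<eta> i = \<eta>' i"
      define B where "B = g -` {g \<eta>} \<inter> space ?M"
      have "B \<in> sets ?M" unfolding B_def using g by (rule measurable_sets) simp
      then have "B \<in> sigma_sets (sign_cube n) (cylinder_algebra n k)"
        using sub by (simp add: sets_measure_of)
      then have "depends_on_first n k (\<lambda>\<eta>. \<eta> \<in> B)"
        by (rule sigma_sets_cylinder_algebra[OF assms])
      then have "(\<eta> \<in> B) = (\<eta>' \<in> B)" using a by (rule depends_on_firstD)
      then show "g \<eta> = g \<eta>'" using a sub by (auto simp: B_def space_measure_of)
    qed
  next
    assume g: "depends_on_first n k g"
    show "g \<in> borel_measurable ?M"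
    proof (rule measurableI)
      fix A :: "'a set"
      have "depends_on_first n k (\<lambda>\<eta>. \<eta> \<in> g -` A \<inter> sign_cube n)"
      proof (rule depends_on_firstI)
        fix \<eta> \<eta>'
        assume a: "\<eta> \<in> sign_cube n" "\<eta>' \<in> sign_cube n" "\<And>i. i \<in> {1..k} \<Longrightarrow> \<eta> i = \<eta>' i"
        have "g \<eta> = g \<eta>'" by (rule depends_on_firstD[OF g a])
        then show "(\<eta> \<in> g -` A \<inter> sign_cube n) = (\<eta>' \<in> g -` A \<inter> sign_cube n)"
          using a(1,2) by simp
      qed
      then have "g -` A \<inter> sign_cube n \<in> cylinder_algebra n k"
        unfolding cylinder_algebra_iff[OF assms] by simp
      then show "g -` A \<inter> space ?M \<in> sets ?M"
        using sub by (simp add: sets_measure_of space_measure_of sigma_sets.Basic)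
    qed simp
  qed
qed

subsection \<open>Characterisation of martingales\<close>

text \<open>On the cube, conditioning a \<open>\<Sigma>\<^sub>k\<close>-measurable function on \<open>\<Sigma>\<^bsub>k-1\<^esub>\<close> means averaging over the two
  values of the \<open>k\<close>-th coordinate. So a Walsh--Paley martingale is the same as an adapted sequence whose
  \<open>k\<close>-th difference changes sign with the \<open>k\<close>-th coordinate. In this form conditional expectations
  disappear, and every expectation below is evaluated by the symmetry of the cube under one flip.\<close>

definition adapted_odd :: "nat \<Rightarrow> (nat \<Rightarrow> (nat \<Rightarrow> real) \<Rightarrow> 'a::real_normed_vector) \<Rightarrow> bool" where
  "adapted_odd n f \<longleftrightarrow> (\<forall>k\<le>n. depends_on_first n k (f k)) \<and>
     (\<forall>k\<in>{1..n}. \<forall>\<eta>\<in>sign_cube n. martingale_diff f k (flip k \<eta>) = - martingale_diff f k \<eta>)"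

lemma adapted_odd_depends: "adapted_odd n f \<Longrightarrow> k \<le> n \<Longrightarrow> depends_on_first n k (f k)"
  and adapted_odd_flip: "adapted_odd n f \<Longrightarrow> k \<in> {1..n} \<Longrightarrow> \<eta> \<in> sign_cube n
    \<Longrightarrow> martingale_diff f k (flip k \<eta>) = - martingale_diff f k \<eta>"
  unfolding adapted_odd_def by blast+

lemma sum_martingale_diff:
  assumes "k \<le> n"
  shows "f n \<eta> = f k \<eta> + (\<Sum>j\<in>{k<..n}. martingale_diff f j \<eta>)"
  using assms
proof (induction n rule: dec_induct)
  case (step m)
  then have "{k<..Suc m} = insert (Suc m) {k<..m}" by auto
  then show ?case using step by (simp add: martingale_diff_def)
qed simp

lemma martingale_diff_flip_later:
  assumes "adapted_odd n f" "1 \<le> k" "k < j" "j \<le> n" "\<eta> \<in> sign_cube n"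
  shows "martingale_diff f k (flip j \<eta>) = martingale_diff f k \<eta>"
proof -
  have "f k (flip j \<eta>) = f k \<eta>"
    using assms by (intro depends_on_first_flip[OF adapted_odd_depends[OF assms(1)]]) auto
  moreover have "f (k - 1) (flip j \<eta>) = f (k - 1) \<eta>"
    using assms by (intro depends_on_first_flip[OF adapted_odd_depends[OF assms(1)]]) auto
  ultimately show ?thesis by (simp add: martingale_diff_def)
qed

text \<open>For a martingale, \<open>f k + f k \<circ> flip k - 2 f (k - 1)\<close> depends on the first \<open>k - 1\<close> coordinates and has
  mean zero on every atom of \<open>\<Sigma>\<^bsub>k-1\<^esub>\<close>, so it vanishes. Conversely, \<open>f n - f k\<close> is a sum of later
  differences, and each of them integrates to zero over a set that its flip preserves.\<close>

lemma walsh_paley_martingale_iff: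
  fixes f :: "nat \<Rightarrow> (nat \<Rightarrow> real) \<Rightarrow> 'a::real_normed_vector"
  shows "walsh_paley_martingale n f \<longleftrightarrow> adapted_odd n f"
proof
  assume wp: "walsh_paley_martingale n f"
  have dep: "depends_on_first n k (f k)" if "k \<le> n" for k
    using wp that measurable_cylinder_algebra_iff[OF that]
    by (auto simp: walsh_paley_martingale_def is_cond_expectation_def)
  have ce: "cube_expectation n (\<lambda>\<eta>. indicator A \<eta> *\<^sub>R f k \<eta>)
      = cube_expectation n (\<lambda>\<eta>. indicator A \<eta> *\<^sub>R f n \<eta>)"
    if "k \<le> n" "A \<in> cylinder_algebra n k" for k A
    using wp that by (auto simp: walsh_paley_martingale_def is_cond_expectation_def)
  have "martingale_diff f k (flip k \<eta>) = - martingale_diff f k \<eta>"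
    if k: "k \<in> {1..n}" and \<eta>: "\<eta> \<in> sign_cube n" for k \<eta>
  proof -
    have k': "k \<le> n" "k - 1 \<le> n" "k - 1 < k" using k by auto
    define u where "u \<zeta> = f k \<zeta> + f k (flip k \<zeta>) - 2 *\<^sub>R f (k - 1) \<zeta>" for \<zeta>
    \<comment> \<open>the atom that contains \<open>\<eta>\<close>\<close>
    define A where "A = {\<zeta> \<in> sign_cube n. \<forall>i\<in>{1..k - 1}. \<eta> i = \<zeta> i}"
    have A_cyl: "A \<in> cylinder_algebra n (k - 1)"
      unfolding cylinder_algebra_iff[OF k'(2)] by (auto simp: A_def depends_on_first_def)
    then have A_cyl': "A \<in> cylinder_algebra n k"
      using k' by (auto simp: cylinder_algebra_iff intro: depends_on_first_mono)
    have A_flip: "indicator A (flip k \<zeta>) = (indicator A \<zeta> :: real)" if "\<zeta> \<in> sign_cube n" for \<zeta>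
    proof -
      have "(flip k \<zeta> \<in> A) = (\<zeta> \<in> A)"
        using A_cyl that k' unfolding cylinder_algebra_iff[OF k'(2)]
        by (intro depends_on_first_flip[of n "k - 1" "\<lambda>\<zeta>. \<zeta> \<in> A"]) auto
      then show ?thesis by (simp add: indicator_def)
    qed
    have "cube_expectation n (\<lambda>\<zeta>. indicator A \<zeta> *\<^sub>R f k (flip k \<zeta>))
        = cube_expectation n (\<lambda>\<zeta>. indicator A (flip k \<zeta>) *\<^sub>R f k (flip k \<zeta>))"
      by (rule cube_expectation_cong) (simp add: A_flip)
    also have "\<dots> = cube_expectation n (\<lambda>\<zeta>. indicator A \<zeta> *\<^sub>R f k \<zeta>)"
      by (rule cube_expectation_flip[OF k])
    finally have "cube_expectation n (\<lambda>\<zeta>. indicator A \<zeta> *\<^sub>R u \<zeta>)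
        = 2 *\<^sub>R cube_expectation n (\<lambda>\<zeta>. indicator A \<zeta> *\<^sub>R f k \<zeta>)
        - 2 *\<^sub>R cube_expectation n (\<lambda>\<zeta>. indicator A \<zeta> *\<^sub>R f (k - 1) \<zeta>)"
      unfolding u_def
      by (simp add: scaleR_add_right scaleR_diff_right cube_expectation_add cube_expectation_diff
          scaleR_2)
    also have "\<dots> = 0" using ce[OF k'(1) A_cyl'] ce[OF k'(2) A_cyl] by simp
    finally have "cube_expectation n (\<lambda>\<zeta>. indicator A \<zeta> *\<^sub>R u \<zeta>) = 0" .
    moreover have "u \<zeta> = u \<eta>" if "\<zeta> \<in> A" for \<zeta>
    proof -
      have "f (k - 1) \<zeta> = f (k - 1) \<eta>"
        by (rule depends_on_firstD[OF dep[OF k'(2)]]) (use that \<eta> in \<open>auto simp: A_def\<close>)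
      moreover have "f k \<zeta> + f k (flip k \<zeta>) = f k \<eta> + f k (flip k \<eta>)"
        by (rule depends_on_firstD[OF depends_on_first_average[OF dep[OF k'(1)] k]])
          (use that \<eta> in \<open>auto simp: A_def\<close>)
      ultimately show ?thesis unfolding u_def by simp
    qed
    then have "cube_expectation n (\<lambda>\<zeta>. indicator A \<zeta> *\<^sub>R u \<zeta>)
        = cube_expectation n (\<lambda>\<zeta>. indicator A \<zeta> *\<^sub>R u \<eta>)"
      by (intro cube_expectation_cong) (metis indicator_simps(2) scaleR_zero_left)
    moreover have "\<dots> = (1 / 2 ^ n * card A) *\<^sub>R u \<eta>"
      unfolding cube_expectation_def scaleR_left.sum[symmetric]
      by (simp add: sum.If_cases indicator_def A_def Int_def flip: of_nat_sum)
    moreover have "card A \<noteq> 0"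
      using \<eta> by (auto simp: A_def)
    ultimately have "u \<eta> = 0" by simp
    moreover have "f (k - 1) (flip k \<eta>) = f (k - 1) \<eta>"
      using k' \<eta> by (intro depends_on_first_flip[OF dep]) auto
    ultimately show ?thesis unfolding u_def martingale_diff_def
      by (simp add: scaleR_2 algebra_simps)
  qed
  then show "adapted_odd n f" using dep by (simp add: adapted_odd_def)
next
  assume f: "adapted_odd n f"
  show "walsh_paley_martingale n f"
    unfolding walsh_paley_martingale_def is_cond_expectation_def
  proof (intro allI impI conjI ballI)
    fix k assume k: "k \<le> n"
    show "f k \<in> borel_measurable (sigma (sign_cube n) (cylinder_algebra n k))"
      using measurable_cylinder_algebra_iff[OF k] adapted_odd_depends[OF f k] by blast
    fix A assume A: "A \<in> cylinder_algebra n k"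
    have zero: "cube_expectation n (\<lambda>\<eta>. indicator A \<eta> *\<^sub>R martingale_diff f j \<eta>) = 0"
      if j: "j \<in> {k<..n}" for j
    proof (rule cube_expectation_odd[of j])
      show j': "j \<in> {1..n}" using j by auto
      fix \<eta> assume \<eta>: "\<eta> \<in> sign_cube n"
      have "(flip j \<eta> \<in> A) = (\<eta> \<in> A)"
        using A j \<eta> unfolding cylinder_algebra_iff[OF k]
        by (intro depends_on_first_flip[of n k "\<lambda>\<zeta>. \<zeta> \<in> A"]) auto
      then show "indicator A (flip j \<eta>) *\<^sub>R martingale_diff f j (flip j \<eta>)
          = - (indicator A \<eta> *\<^sub>R martingale_diff f j \<eta>)"
        using adapted_odd_flip[OF f j' \<eta>] by (simp add: indicator_def)
    qed
    have "cube_expectation n (\<lambda>\<eta>. indicator A \<eta> *\<^sub>R f n \<eta>)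
        = cube_expectation n (\<lambda>\<eta>. indicator A \<eta> *\<^sub>R f k \<eta>
            + (\<Sum>j\<in>{k<..n}. indicator A \<eta> *\<^sub>R martingale_diff f j \<eta>))"
      by (subst sum_martingale_diff[OF k, of f]) (simp add: scaleR_add_right scaleR_sum_right)
    also have "\<dots> = cube_expectation n (\<lambda>\<eta>. indicator A \<eta> *\<^sub>R f k \<eta>)"
      unfolding cube_expectation_add cube_expectation_sum
      using sum.neutral[of "{k<..n}", OF ballI, OF zero] by simp
    finally show "cube_expectation n (\<lambda>\<eta>. indicator A \<eta> *\<^sub>R f k \<eta>)
        = cube_expectation n (\<lambda>\<eta>. indicator A \<eta> *\<^sub>R f n \<eta>)" ..
  qed
qed

text \<open>The conditional expectations of \<open>g\<close> arise by averaging over the coordinates \<open>n\<close>, \<open>n - 1\<close>, and so on,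
  one after the other.\<close>

lemma martingale_with_terminal_value:
  fixes g :: "(nat \<Rightarrow> real) \<Rightarrow> 'a::real_normed_vector"
  obtains G where "adapted_odd n G" "G n = g"
proof -
  define A where "A = rec_nat g (\<lambda>m h \<eta>. (1/2) *\<^sub>R (h \<eta> + h (flip (n - m) \<eta>)))"
  have A0: "A 0 = g" and A_Suc: "A (Suc m) = (\<lambda>\<eta>. (1/2) *\<^sub>R (A m \<eta> + A m (flip (n - m) \<eta>)))" for m
    by (simp_all add: A_def)
  have dep: "m \<le> n \<Longrightarrow> depends_on_first n (n - m) (A m)" for m
  proof (induction m)
    case 0
    show ?case
    proof (rule depends_on_firstI)
      fix \<eta> \<eta>' assume "\<eta> \<in> sign_cube n" "\<eta>' \<in> sign_cube n" "\<And>i. i \<in> {1..n - 0} \<Longrightarrow> \<eta> i = \<eta>' i"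
      then have "\<eta> = \<eta>'" unfolding sign_cube_def by (intro PiE_ext) auto
      then show "A 0 \<eta> = A 0 \<eta>'" by simp
    qed
  next
    case (Suc m)
    then have avg: "depends_on_first n (n - m - 1) (\<lambda>\<eta>. A m \<eta> + A m (flip (n - m) \<eta>))"
      by (intro depends_on_first_average) auto
    have pred: "n - Suc m = n - m - 1" by simp
    show ?case unfolding A_Suc pred by (rule depends_on_first_comp[OF avg])
  qed
  define G where "G k = A (n - k)" for k
  have "martingale_diff G k (flip k \<eta>) = - martingale_diff G k \<eta>" if k: "k \<in> {1..n}" for k \<eta>
  proof -
    have "n - (k - 1) = Suc (n - k)" "n - (n - k) = k" using k by auto
    then have avg: "G (k - 1) \<zeta> = (1/2) *\<^sub>R (G k \<zeta> + G k (flip k \<zeta>))" for \<zeta>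
      unfolding G_def by (simp only: A_Suc)
    define s where "s = (1/2) *\<^sub>R (G k \<eta> + G k (flip k \<eta>))"
    have "s + s = G k \<eta> + G k (flip k \<eta>)"
      unfolding scaleR_2[symmetric] by (simp only: s_def scaleR_scaleR) simp
    then have "G k (flip k \<eta>) - s = - (G k \<eta> - s)" by (simp add: algebra_simps)
    then show ?thesis
      unfolding martingale_diff_def avg flip_flip add.commute[of "G k (flip k \<eta>)"] s_def .
  qed
  moreover have "depends_on_first n k (G k)" if "k \<le> n" for k
    using dep[of "n - k"] that by (simp add: G_def)
  ultimately have "adapted_odd n G" by (simp add: adapted_odd_def)
  moreover have "G n = g" by (simp add: G_def A0)
  ultimately show ?thesis by (rule that)
qed

lemma adapted_odd_linear_combination:
  assumes f: "adapted_odd n f" and g: "adapted_odd n g"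
  shows "adapted_odd n (\<lambda>k \<eta>. a *\<^sub>R f k \<eta> + b *\<^sub>R g k \<eta>)"
  unfolding adapted_odd_def
proof (intro conjI allI ballI impI)
  fix k assume k: "k \<le> n"
  show "depends_on_first n k (\<lambda>\<eta>. a *\<^sub>R f k \<eta> + b *\<^sub>R g k \<eta>)"
  proof (rule depends_on_firstI)
    fix \<eta> \<eta>'
    assume *: "\<eta> \<in> sign_cube n" "\<eta>' \<in> sign_cube n" "\<And>i. i \<in> {1..k} \<Longrightarrow> \<eta> i = \<eta>' i"
    have "f k \<eta> = f k \<eta>'" by (rule depends_on_firstD[OF adapted_odd_depends[OF f k] *])
    moreover have "g k \<eta> = g k \<eta>'" by (rule depends_on_firstD[OF adapted_odd_depends[OF g k] *])
    ultimately show "a *\<^sub>R f k \<eta> + b *\<^sub>R g k \<eta> = a *\<^sub>R f k \<eta>' + b *\<^sub>R g k \<eta>'" by simp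
  qed
next
  fix k \<eta> assume k: "k \<in> {1..n}" and \<eta>: "\<eta> \<in> sign_cube n"
  have diff: "martingale_diff (\<lambda>k \<eta>. a *\<^sub>R f k \<eta> + b *\<^sub>R g k \<eta>) k \<zeta>
      = a *\<^sub>R martingale_diff f k \<zeta> + b *\<^sub>R martingale_diff g k \<zeta>" for \<zeta>
    by (simp add: martingale_diff_def scaleR_diff_right)
  show "martingale_diff (\<lambda>k \<eta>. a *\<^sub>R f k \<eta> + b *\<^sub>R g k \<eta>) k (flip k \<eta>)
      = - martingale_diff (\<lambda>k \<eta>. a *\<^sub>R f k \<eta> + b *\<^sub>R g k \<eta>) k \<eta>"
    unfolding diff adapted_odd_flip[OF f k \<eta>] adapted_odd_flip[OF g k \<eta>] by simp
qed

text \<open>Differences with distinct indices are orthogonal for every bounded bilinear pairing: flipping the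
  coordinate with the larger index negates one factor and fixes the other.\<close>

lemma martingale_pairing:
  fixes B :: "'a::real_normed_vector \<Rightarrow>\<^sub>L ('b::real_normed_vector \<Rightarrow>\<^sub>L real)"
  assumes f: "adapted_odd n f" and g: "adapted_odd n g" and k: "k \<in> {1..n}"
  shows "cube_expectation n (\<lambda>\<eta>. B (martingale_diff f k \<eta>) (g n \<eta>))
    = cube_expectation n (\<lambda>\<eta>. B (martingale_diff f k \<eta>) (martingale_diff g k \<eta>))"
proof -
  have k': "1 \<le> k" "k \<le> n" using k by auto
  have later: "cube_expectation n (\<lambda>\<eta>. B (martingale_diff f k \<eta>) (martingale_diff g j \<eta>)) = 0"
    if j: "j \<in> {k<..n}" for j
  proof (rule cube_expectation_odd[of j])
    show j': "j \<in> {1..n}" using j by auto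
    fix \<eta> assume \<eta>: "\<eta> \<in> sign_cube n"
    have "martingale_diff f k (flip j \<eta>) = martingale_diff f k \<eta>"
      using martingale_diff_flip_later[OF f] j k' \<eta> by simp
    then show "B (martingale_diff f k (flip j \<eta>)) (martingale_diff g j (flip j \<eta>))
        = - B (martingale_diff f k \<eta>) (martingale_diff g j \<eta>)"
      using adapted_odd_flip[OF g j' \<eta>] by (simp add: blinfun.minus_right)
  qed
  have earlier: "cube_expectation n (\<lambda>\<eta>. B (martingale_diff f k \<eta>) (g (k - 1) \<eta>)) = 0"
  proof (rule cube_expectation_odd[OF k])
    fix \<eta> assume \<eta>: "\<eta> \<in> sign_cube n"
    have "g (k - 1) (flip k \<eta>) = g (k - 1) \<eta>"
      using k' \<eta> by (intro depends_on_first_flip[OF adapted_odd_depends[OF g]]) auto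
    then show "B (martingale_diff f k (flip k \<eta>)) (g (k - 1) (flip k \<eta>))
        = - B (martingale_diff f k \<eta>) (g (k - 1) \<eta>)"
      using adapted_odd_flip[OF f k \<eta>] by (simp add: blinfun.minus_right blinfun.minus_left)
  qed
  have split: "g n \<eta> = g (k - 1) \<eta> + martingale_diff g k \<eta> + (\<Sum>j\<in>{k<..n}. martingale_diff g j \<eta>)" for \<eta>
    using sum_martingale_diff[OF k'(2), of g \<eta>] by (simp add: martingale_diff_def)
  show ?thesis
    unfolding split blinfun.add_right blinfun.sum_right cube_expectation_add cube_expectation_sum
      earlier
    using sum.neutral[of "{k<..n}", OF ballI, OF later] by simp
qed

section \<open>From delta-convexity to the square function estimate\<close>

lemma convex_on_midpoint:
  assumes "convex_on U F" "a + d \<in> U" "a - d \<in> U"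
  shows "2 * F a \<le> F (a + d) + (F (a - d) :: real)"
proof -
  have "F ((1 - 1/2) *\<^sub>R (a + d) + (1/2) *\<^sub>R (a - d)) \<le> (1 - 1/2) * F (a + d) + 1/2 * F (a - d)"
    using assms by (intro convex_onD) auto
  moreover have "(1 - 1/2) *\<^sub>R (a + d) + (1/2) *\<^sub>R (a - d) = a"
    by (simp add: algebra_simps flip: scaleR_add_left)
  ultimately show ?thesis by simp
qed

text \<open>Given the first \<open>k - 1\<close> coordinates, \<open>f k\<close> takes the two values \<open>a + d\<close> and \<open>a - d\<close> with \<open>a = f (k - 1)\<close>. The
  second difference of \<open>Q\<close> is the constant \<open>2 * Q d\<close>, so midpoint convexity of \<open>P + Q\<close> and \<open>P - Q\<close> says that
  the mean of \<open>P\<close> increases by at least \<open>\<bar>Q d\<bar>\<close> in this step.\<close>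

lemma convex_martingale_increments:
  fixes P Q :: "'a::real_normed_vector \<Rightarrow> real"
  assumes parallelogram: "\<And>x h. Q (x + h) + Q (x - h) = 2 * Q x + 2 * Q h"
    and plus: "convex_on U (\<lambda>x. P x + Q x)" and minus: "convex_on U (\<lambda>x. P x - Q x)"
    and f: "adapted_odd n f" and range: "\<And>k \<eta>. k \<le> n \<Longrightarrow> \<eta> \<in> sign_cube n \<Longrightarrow> f k \<eta> \<in> U"
  shows "(\<Sum>k = 1..n. cube_expectation n (\<lambda>\<eta>. \<bar>Q (martingale_diff f k \<eta>)\<bar>))
    \<le> cube_expectation n (\<lambda>\<eta>. P (f n \<eta>)) - cube_expectation n (\<lambda>\<eta>. P (f 0 \<eta>))"
proof -
  let ?E = "cube_expectation n"
  have step: "?E (\<lambda>\<eta>. \<bar>Q (martingale_diff f k \<eta>)\<bar>) \<le> ?E (\<lambda>\<eta>. P (f k \<eta>)) - ?E (\<lambda>\<eta>. P (f (k - 1) \<eta>))"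
    if k: "k \<in> {1..n}" for k
  proof -
    have k': "k - 1 < k" "k \<le> n" "k - 1 \<le> n" using k by auto
    have "\<bar>Q (martingale_diff f k \<eta>)\<bar> + P (f (k - 1) \<eta>) \<le> 1/2 * (P (f k \<eta>) + P (f k (flip k \<eta>)))"
      if \<eta>: "\<eta> \<in> sign_cube n" for \<eta>
    proof -
      define a d where "a = f (k - 1) \<eta>" and "d = martingale_diff f k \<eta>"
      have 1: "f k \<eta> = a + d" by (simp add: a_def d_def martingale_diff_def)
      have "f (k - 1) (flip k \<eta>) = a"
        unfolding a_def using k' \<eta> by (intro depends_on_first_flip[OF adapted_odd_depends[OF f]]) auto
      then have 2: "f k (flip k \<eta>) = a - d"
        using adapted_odd_flip[OF f k \<eta>] unfolding d_def[symmetric]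
        by (simp add: martingale_diff_def algebra_simps)
      have U: "a + d \<in> U" "a - d \<in> U"
        using range[OF k'(2) \<eta>] range[OF k'(2) flip_in_sign_cube[OF k \<eta>]] unfolding 1 2 .
      show ?thesis
        using convex_on_midpoint[OF plus U] convex_on_midpoint[OF minus U] parallelogram[of a d]
        unfolding 1 2 a_def[symmetric] d_def[symmetric] by (simp add: abs_if)
    qed
    then have "?E (\<lambda>\<eta>. \<bar>Q (martingale_diff f k \<eta>)\<bar> + P (f (k - 1) \<eta>))
        \<le> ?E (\<lambda>\<eta>. 1/2 * (P (f k \<eta>) + P (f k (flip k \<eta>))))"
      by (rule cube_expectation_mono)
    then show ?thesis
      unfolding cube_expectation_cmult cube_expectation_add
        cube_expectation_flip[OF k, of "\<lambda>\<eta>. P (f k \<eta>)"] by simp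
  qed
  have "(\<Sum>k = 1..m. ?E (\<lambda>\<eta>. \<bar>Q (martingale_diff f k \<eta>)\<bar>)) \<le> ?E (\<lambda>\<eta>. P (f m \<eta>)) - ?E (\<lambda>\<eta>. P (f 0 \<eta>))"
    if "m \<le> n" for m
    using that
  proof (induction m)
    case (Suc m)
    then show ?case using step[of "Suc m"] by simp
  qed simp
  then show ?thesis by simp
qed

locale symmetric_form =
  fixes T :: "'a::real_normed_vector \<Rightarrow>\<^sub>L ('a \<Rightarrow>\<^sub>L real)"
  assumes symmetric: "T x y = T y x"
begin

definition form :: "'a \<Rightarrow> real" where
  "form x = T x x"

lemma form_parallelogram: "form (x + h) + form (x - h) = 2 * form x + 2 * form h"
  unfolding form_def by (simp add: blinfun.bilinear_simps)

lemma form_scaleR: "form (c *\<^sub>R x) = c\<^sup>2 * form x"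
  unfolding form_def by (simp add: blinfun.bilinear_simps power2_eq_square)

lemma form_minus: "form (- x) = form x"
  unfolding form_def by (simp add: blinfun.bilinear_simps)

lemma form_0: "form 0 = 0"
  unfolding form_def by simp

lemma form_polarization: "4 * T x y = form (x + y) - form (x - y)"
  unfolding form_def using symmetric[of x y] by (simp add: blinfun.bilinear_simps)

lemma continuous_on_form: "continuous_on S form"
  unfolding form_def by (intro continuous_intros)

lemma abs_form_le: "\<bar>form x\<bar> \<le> norm T * (norm x)\<^sup>2"
proof -
  have "\<bar>form x\<bar> \<le> norm (T x) * norm x"
    unfolding form_def using norm_blinfun[of "T x" x] by simp
  also have "\<dots> \<le> (norm T * norm x) * norm x"
    by (intro mult_right_mono norm_blinfun) auto
  finally show ?thesis by (simp add: power2_eq_square mult_ac)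
qed

text \<open>If \<open>form = f - g\<close>, then \<open>f + g\<close> becomes \<open>2 f\<close> or \<open>2 g\<close> when \<open>form\<close> is added or subtracted. The mean of
  \<open>f + g\<close> and its reflection, shifted to vanish at 0, keeps this property because \<open>form\<close> is even, and is
  nonnegative by convexity. By continuity it is at most 1 on some ball; dilating this ball to
  the unit ball replaces \<open>form\<close> by \<open>\<delta>\<^sup>2 * form\<close>. The bound by the norm follows by convexity along rays.\<close>

lemma normalised_convex_majorant:
  assumes "delta_convex form"
  obtains p \<delta> where "\<delta> > 0" "continuous_on UNIV p" "\<And>x. 0 \<le> p x" "\<And>x. norm x \<le> 1 \<Longrightarrow> p x \<le> norm x"
    "convex_on UNIV (\<lambda>x. p x + \<delta>\<^sup>2 * form x)" "convex_on UNIV (\<lambda>x. p x - \<delta>\<^sup>2 * form x)"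
proof -
  obtain f g where f: "convex_on UNIV f" "continuous_on UNIV f"
    and g: "convex_on UNIV g" "continuous_on UNIV g" and fg: "\<And>x. form x = f x - g x"
    using assms unfolding delta_convex_def by blast
  define p1 where "p1 x = ((f x + g x) + (f (- x) + g (- x))) / 2 - (f 0 + g 0)" for x
  have fg_minus: "form x = f (- x) - g (- x)" for x using fg[of "- x"] form_minus by simp
  have cont_p1: "continuous_on UNIV p1"
    unfolding p1_def by (intro continuous_intros f g continuous_on_compose2[OF f(2)]
        continuous_on_compose2[OF g(2)]) auto
  have sym_convex: "convex_on UNIV (\<lambda>x. h x + h (- x) + c)" if "convex_on UNIV h" for h :: "'a \<Rightarrow> real" and c
    using convex_on_comp_scaleR[OF that, of "-1"] that
    by (intro convex_on_add) (simp_all add: convex_on_const)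
  have plus1: "convex_on UNIV (\<lambda>x. p1 x + form x)"
    by (rule convex_on_transfer[OF sym_convex[OF f(1), of "- (f 0 + g 0)"]])
      (use fg fg_minus in \<open>simp add: p1_def field_simps, smt (verit)\<close>)
  have minus1: "convex_on UNIV (\<lambda>x. p1 x - form x)"
    by (rule convex_on_transfer[OF sym_convex[OF g(1), of "- (f 0 + g 0)"]])
      (use fg fg_minus in \<open>simp add: p1_def field_simps, smt (verit)\<close>)
  have p1_nonneg: "0 \<le> p1 x" for x
    using convex_on_midpoint[OF f(1), of 0 x] convex_on_midpoint[OF g(1), of 0 x]
    by (simp add: p1_def field_simps)
  have p1_0: "p1 0 = 0" by (simp add: p1_def)
  have "isCont p1 0" using cont_p1 by (simp add: continuous_on_eq_continuous_at)
  then obtain e where e: "e > 0" "\<And>x. norm x < e \<Longrightarrow> \<bar>p1 x\<bar> < 1"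
    unfolding continuous_at_eps_delta using p1_0
    by (metis diff_zero dist_0_norm dist_commute dist_norm real_norm_def zero_less_one)
  define \<delta> where "\<delta> = e / 2"
  have \<delta>: "\<delta> > 0" "\<delta> < e" using e by (simp_all add: \<delta>_def)
  define p where "p x = p1 (\<delta> *\<^sub>R x)" for x
  have plus: "convex_on UNIV (\<lambda>x. p x + \<delta>\<^sup>2 * form x)"
    using convex_on_comp_scaleR[OF plus1, of \<delta>] by (simp add: p_def form_scaleR)
  have minus: "convex_on UNIV (\<lambda>x. p x - \<delta>\<^sup>2 * form x)"
    using convex_on_comp_scaleR[OF minus1, of \<delta>] by (simp add: p_def form_scaleR)
  have convex_p: "convex_on UNIV p"
  proof (rule convex_on_transfer)
    show "convex_on UNIV (\<lambda>x. 1/2 * ((p x + \<delta>\<^sup>2 * form x) + (p x - \<delta>\<^sup>2 * form x)))"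
      by (intro convex_on_cmul convex_on_add plus minus) simp
  qed simp
  show ?thesis
  proof
    show "\<delta> > 0" by (rule \<delta>)
    show "continuous_on UNIV p"
      unfolding p_def by (intro continuous_on_compose2[OF cont_p1] continuous_intros) auto
    show "0 \<le> p x" for x unfolding p_def by (rule p1_nonneg)
    show "p x \<le> norm x" if x: "norm x \<le> 1" for x
    proof (cases "x = 0")
      case False
      define v where "v = (1 / norm x) *\<^sub>R x"
      have v: "norm v = 1" "x = norm x *\<^sub>R v" using False by (simp_all add: v_def)
      have "p v \<le> 1" unfolding p_def using e(2)[of "\<delta> *\<^sub>R v"] \<delta> v by simp
      have "p ((1 - norm x) *\<^sub>R 0 + norm x *\<^sub>R v) \<le> (1 - norm x) * p 0 + norm x * p v"
        by (rule convex_onD[OF convex_p]) (use x in auto)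
      also have "\<dots> \<le> norm x * 1"
        using \<open>p v \<le> 1\<close> p1_0 by (simp add: p_def mult_left_le)
      finally show ?thesis using v by simp
    qed (simp add: p_def p1_0)
  qed (rule plus, rule minus)
qed

text \<open>A martingale has finitely many values, so it stays in a ball on which the glued majorant lives.
  The increments of the majorant along the martingale sum to at most \<open>9 E \<bar>f\<^sub>n\<bar>\<^sup>2 + 1\<close>, whatever the
  radius of the ball is, and the constant disappears by homogeneity.\<close>

lemma square_estimate_if_delta_convex:
  assumes "delta_convex form"
  shows "\<exists>C>0. \<forall>n f. adapted_odd n f \<longrightarrow>
    (\<Sum>k = 1..n. cube_expectation n (\<lambda>\<eta>. \<bar>form (martingale_diff f k \<eta>)\<bar>))
    \<le> C * cube_expectation n (\<lambda>\<eta>. (norm (f n \<eta>))\<^sup>2)"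
proof -
  obtain p \<delta> where \<delta>: "\<delta> > 0" and p: "continuous_on UNIV p" "\<And>x. 0 \<le> p x" "\<And>x. norm x \<le> 1 \<Longrightarrow> p x \<le> norm x"
    "convex_on UNIV (\<lambda>x. p x + \<delta>\<^sup>2 * form x)" "convex_on UNIV (\<lambda>x. p x - \<delta>\<^sup>2 * form x)"
    by (rule normalised_convex_majorant[OF assms]) (rule that)
  have affine: "\<delta>\<^sup>2 * (\<Sum>k = 1..n. cube_expectation n (\<lambda>\<eta>. \<bar>form (martingale_diff f k \<eta>)\<bar>))
      \<le> 9 * cube_expectation n (\<lambda>\<eta>. (norm (f n \<eta>))\<^sup>2) + 1"
    if f: "adapted_odd n f" for n f
  proof -
    let ?E = "cube_expectation n"
    obtain N where N: "(\<Sum>k\<le>n. \<Sum>\<eta>\<in>sign_cube n. norm (f k \<eta>)) < 2 ^ N"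
      using real_arch_pow[of 2] by auto
    have range: "f k \<eta> \<in> ball 0 (2 ^ N)" if "k \<le> n" "\<eta> \<in> sign_cube n" for k \<eta>
    proof -
      have "norm (f k \<eta>) \<le> (\<Sum>\<eta>\<in>sign_cube n. norm (f k \<eta>))"
        using that by (intro member_le_sum) auto
      also have "\<dots> \<le> (\<Sum>k\<le>n. \<Sum>\<eta>\<in>sign_cube n. norm (f k \<eta>))"
        using that by (intro member_le_sum[of k "{..n}" "\<lambda>k. \<Sum>\<eta>\<in>sign_cube n. norm (f k \<eta>)"])
          (auto intro: sum_nonneg)
      finally show ?thesis using N by simp
    qed
    obtain P where P: "convex_on (ball 0 (2 ^ N)) (\<lambda>x. P x + \<delta>\<^sup>2 * form x)"
        "convex_on (ball 0 (2 ^ N)) (\<lambda>x. P x - \<delta>\<^sup>2 * form x)"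
      and P_bounds: "\<And>x. x \<in> ball 0 (2 ^ N) \<Longrightarrow> -1 \<le> P x \<and> P x \<le> 9 * (norm x)\<^sup>2"
    proof -
      have "continuous_on UNIV (\<lambda>x. \<delta>\<^sup>2 * form x)"
        by (intro continuous_on_mult_left continuous_on_form)
      moreover have "\<delta>\<^sup>2 * form (c *\<^sub>R x) = c\<^sup>2 * (\<delta>\<^sup>2 * form x)" for c x
        by (simp add: form_scaleR)
      ultimately show thesis
        using glued_convex_function[of p "\<lambda>x. \<delta>\<^sup>2 * form x" N] p that by blast
    qed
    have "(\<Sum>k = 1..n. ?E (\<lambda>\<eta>. \<bar>\<delta>\<^sup>2 * form (martingale_diff f k \<eta>)\<bar>))
        \<le> ?E (\<lambda>\<eta>. P (f n \<eta>)) - ?E (\<lambda>\<eta>. P (f 0 \<eta>))"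
    proof (rule convex_martingale_increments[OF _ P f range])
      show "\<delta>\<^sup>2 * form (x + h) + \<delta>\<^sup>2 * form (x - h) = 2 * (\<delta>\<^sup>2 * form x) + 2 * (\<delta>\<^sup>2 * form h)" for x h
        unfolding distrib_left[symmetric] form_parallelogram by (simp add: algebra_simps)
    qed
    moreover have "?E (\<lambda>\<eta>. P (f n \<eta>)) \<le> ?E (\<lambda>\<eta>. 9 * (norm (f n \<eta>))\<^sup>2)"
      using P_bounds range by (intro cube_expectation_mono) auto
    moreover have "?E (\<lambda>\<eta>. -1) \<le> ?E (\<lambda>\<eta>. P (f 0 \<eta>))"
      using P_bounds range by (intro cube_expectation_mono) auto
    ultimately show ?thesis
      by (simp add: abs_mult cube_expectation_cmult cube_expectation_const flip: sum_distrib_left)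
  qed
  have "(\<Sum>k = 1..n. cube_expectation n (\<lambda>\<eta>. \<bar>form (martingale_diff f k \<eta>)\<bar>))
      \<le> 9 / \<delta>\<^sup>2 * cube_expectation n (\<lambda>\<eta>. (norm (f n \<eta>))\<^sup>2)"
    if f: "adapted_odd n f" for n f
  proof -
    define S where "S = (\<Sum>k = 1..n. cube_expectation n (\<lambda>\<eta>. \<bar>form (martingale_diff f k \<eta>)\<bar>))"
    define D where "D = \<delta>\<^sup>2 * S - 9 * cube_expectation n (\<lambda>\<eta>. (norm (f n \<eta>))\<^sup>2)"
    \<comment> \<open>applying the affine estimate to multiples of f removes its constant term\<close>
    have scaled: "t\<^sup>2 * D \<le> 1" for t
    proof -
      have diff: "martingale_diff (\<lambda>k \<eta>. t *\<^sub>R f k \<eta>) k \<eta> = t *\<^sub>R martingale_diff f k \<eta>" for k \<eta>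
        by (simp add: martingale_diff_def scaleR_diff_right)
      have "adapted_odd n (\<lambda>k \<eta>. t *\<^sub>R f k \<eta>)"
        using adapted_odd_linear_combination[OF f f, of t 0] by simp
      from affine[OF this] show ?thesis
        unfolding diff form_scaleR S_def D_def
        by (simp add: abs_mult cube_expectation_cmult power_mult_distrib algebra_simps
            flip: sum_distrib_left)
    qed
    have "D \<le> 0"
    proof (rule ccontr)
      assume "\<not> D \<le> 0"
      then show False using scaled[of "sqrt (2 / D)"] by simp
    qed
    then show ?thesis unfolding D_def S_def[symmetric] using \<delta> by (simp add: field_simps)
  qed
  moreover have "9 / \<delta>\<^sup>2 > 0" using \<delta> by simp
  ultimately show ?thesis by blast
qed

end

section \<open>From the square function estimate to the UMD property\<close>

lemma almost_norming_vector:
  fixes L :: "'a::real_normed_vector \<Rightarrow>\<^sub>L real"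
  shows "\<exists>v. norm v \<le> norm L \<and> (norm L)\<^sup>2 / 2 \<le> L v"
proof (cases "L = 0")
  case False
  have "\<exists>v. norm L / 2 * norm v < norm (L v)"
  proof (rule ccontr)
    assume "\<nexists>v. norm L / 2 * norm v < norm (L v)"
    then have "norm L \<le> norm L / 2" by (intro norm_blinfun_bound) (auto simp: not_less)
    then show False using False by simp
  qed
  then obtain v where v: "norm L / 2 * norm v < \<bar>L v\<bar>" by auto
  then have v0: "norm v > 0" by (cases "v = 0") auto
  define w where "w = (sgn (L v) * (norm L / norm v)) *\<^sub>R v"
  have "norm w \<le> norm L" using v0 by (simp add: w_def abs_mult sgn_if)
  moreover have "L w = norm L / norm v * \<bar>L v\<bar>"
    by (simp add: w_def blinfun.scaleR_right abs_sgn)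
  then have "(norm L)\<^sup>2 / 2 \<le> L w"
    using v v0 mult_left_mono[OF less_imp_le[OF v], of "norm L / norm v"]
    by (simp add: power2_eq_square)
  ultimately show ?thesis by blast
qed auto

context symmetric_form
begin

text \<open>Let \<open>G\<close> be the transform. A martingale \<open>g\<close> with terminal value \<open>\<mu> * v\<close>, where \<open>v\<close> almost norms \<open>G\<close>, satisfies
  \<open>E (G g\<^sub>n) \<ge> \<mu> / 2 * E \<bar>G\<bar>\<^sup>2\<close>. The left-hand side collapses to the sum of \<open>\<epsilon>\<^sub>k E (T df\<^sub>k dg\<^sub>k)\<close>, and polarization
  with the hypothesis for \<open>f + g\<close> and \<open>f - g\<close> bounds it by \<open>C (E \<bar>f\<^sub>n\<bar>\<^sup>2 + \<mu>\<^sup>2 E \<bar>G\<bar>\<^sup>2)\<close>. As the last term is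
  quadratic in \<open>\<mu>\<close>, a small \<open>\<mu>\<close> lets it be absorbed; \<open>\<mu> = 1 / (4 * C)\<close> halves the left-hand side.\<close>

lemma transform_bound_if_square_estimate:
  assumes C: "C > 0" and bound: "\<And>n f. adapted_odd n f \<Longrightarrow>
      (\<Sum>k = 1..n. cube_expectation n (\<lambda>\<eta>. \<bar>form (martingale_diff f k \<eta>)\<bar>))
      \<le> C * cube_expectation n (\<lambda>\<eta>. (norm (f n \<eta>))\<^sup>2)"
    and f: "adapted_odd n f" and \<epsilon>: "\<And>k. k \<in> {1..n} \<Longrightarrow> \<epsilon> k \<in> signs"
  shows "cube_expectation n (\<lambda>\<eta>. (norm (\<Sum>k = 1..n. \<epsilon> k *\<^sub>R T (martingale_diff f k \<eta>)))\<^sup>2)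
    \<le> 16 * C\<^sup>2 * cube_expectation n (\<lambda>\<eta>. (norm (f n \<eta>))\<^sup>2)"
proof -
  let ?E = "cube_expectation n"
  define G where "G \<eta> = (\<Sum>k = 1..n. \<epsilon> k *\<^sub>R T (martingale_diff f k \<eta>))" for \<eta>
  define F where "F = ?E (\<lambda>\<eta>. (norm (f n \<eta>))\<^sup>2)"
  define H where "H = ?E (\<lambda>\<eta>. (norm (G \<eta>))\<^sup>2)"
  define \<mu> where "\<mu> = 1 / (4 * C)"
  obtain v where v: "\<And>\<eta>. norm (v \<eta>) \<le> norm (G \<eta>)" "\<And>\<eta>. (norm (G \<eta>))\<^sup>2 / 2 \<le> G \<eta> (v \<eta>)"
    using choice[of "\<lambda>\<eta> v. norm v \<le> norm (G \<eta>) \<and> (norm (G \<eta>))\<^sup>2 / 2 \<le> G \<eta> v"]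
      almost_norming_vector by blast
  obtain g where g: "adapted_odd n g" and g_n: "g n = (\<lambda>\<eta>. \<mu> *\<^sub>R v \<eta>)"
    by (rule martingale_with_terminal_value)
  have \<mu>: "\<mu> > 0" using C by (simp add: \<mu>_def)
  have g_norm: "?E (\<lambda>\<eta>. (norm (g n \<eta>))\<^sup>2) \<le> \<mu>\<^sup>2 * H"
    unfolding H_def cube_expectation_cmult[symmetric] g_n
    using v(1) by (intro cube_expectation_mono) (simp add: power_mult_distrib mult_left_mono power_mono)
  have fg: "adapted_odd n (\<lambda>k \<eta>. f k \<eta> + g k \<eta>)" "adapted_odd n (\<lambda>k \<eta>. f k \<eta> - g k \<eta>)"
    using adapted_odd_linear_combination[OF f g, of 1 1] adapted_odd_linear_combination[OF f g, of 1 "-1"]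
    by simp_all
  let ?d = "martingale_diff"
  have "\<mu> / 2 * H \<le> ?E (\<lambda>\<eta>. G \<eta> (g n \<eta>))"
    unfolding H_def cube_expectation_cmult[symmetric] g_n
    using v(2) \<mu> by (intro cube_expectation_mono) (simp add: blinfun.scaleR_right field_simps)
  also have "\<dots> = (\<Sum>k = 1..n. \<epsilon> k * ?E (\<lambda>\<eta>. T (?d f k \<eta>) (g n \<eta>)))"
    unfolding G_def
    by (simp add: blinfun.sum_left blinfun.scaleR_left cube_expectation_sum cube_expectation_cmult)
  also have "\<dots> = (\<Sum>k = 1..n. \<epsilon> k * ?E (\<lambda>\<eta>. T (?d f k \<eta>) (?d g k \<eta>)))"
    by (intro sum.cong refl) (simp add: martingale_pairing[OF f g])
  also have "\<dots> \<le> (\<Sum>k = 1..n. 1/4 * (?E (\<lambda>\<eta>. \<bar>form (?d f k \<eta> + ?d g k \<eta>)\<bar>)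
      + ?E (\<lambda>\<eta>. \<bar>form (?d f k \<eta> - ?d g k \<eta>)\<bar>)))"
  proof (rule sum_mono)
    fix k assume k: "k \<in> {1..n}"
    have "\<epsilon> k * T (?d f k \<eta>) (?d g k \<eta>)
        \<le> 1/4 * (\<bar>form (?d f k \<eta> + ?d g k \<eta>)\<bar> + \<bar>form (?d f k \<eta> - ?d g k \<eta>)\<bar>)" for \<eta>
      using form_polarization[of "?d f k \<eta>" "?d g k \<eta>"] \<epsilon>[OF k] by (auto simp: signs_def)
    then show "\<epsilon> k * ?E (\<lambda>\<eta>. T (?d f k \<eta>) (?d g k \<eta>))
        \<le> 1/4 * (?E (\<lambda>\<eta>. \<bar>form (?d f k \<eta> + ?d g k \<eta>)\<bar>) + ?E (\<lambda>\<eta>. \<bar>form (?d f k \<eta> - ?d g k \<eta>)\<bar>))"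
      unfolding cube_expectation_cmult[symmetric] cube_expectation_add[symmetric]
      by (intro cube_expectation_mono)
  qed
  also have "\<dots> = 1/4 * ((\<Sum>k = 1..n. ?E (\<lambda>\<eta>. \<bar>form (?d (\<lambda>k \<eta>. f k \<eta> + g k \<eta>) k \<eta>)\<bar>))
      + (\<Sum>k = 1..n. ?E (\<lambda>\<eta>. \<bar>form (?d (\<lambda>k \<eta>. f k \<eta> - g k \<eta>) k \<eta>)\<bar>)))"
    by (simp add: martingale_diff_def sum.distrib sum_divide_distrib algebra_simps)
  also have "\<dots> \<le> 1/4 * (C * ?E (\<lambda>\<eta>. (norm (f n \<eta> + g n \<eta>))\<^sup>2) + C * ?E (\<lambda>\<eta>. (norm (f n \<eta> - g n \<eta>))\<^sup>2))"
    using bound[OF fg(1)] bound[OF fg(2)] by simp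
  also have "\<dots> = C / 4 * ?E (\<lambda>\<eta>. (norm (f n \<eta> + g n \<eta>))\<^sup>2 + (norm (f n \<eta> - g n \<eta>))\<^sup>2)"
    by (simp add: cube_expectation_add algebra_simps)
  also have "\<dots> \<le> C / 4 * ?E (\<lambda>\<eta>. 4 * ((norm (f n \<eta>))\<^sup>2 + (norm (g n \<eta>))\<^sup>2))"
  proof (intro mult_left_mono cube_expectation_mono)
    fix \<eta>
    let ?a = "norm (f n \<eta>)" and ?b = "norm (g n \<eta>)"
    have "(norm (f n \<eta> + g n \<eta>))\<^sup>2 \<le> (?a + ?b)\<^sup>2" "(norm (f n \<eta> - g n \<eta>))\<^sup>2 \<le> (?a + ?b)\<^sup>2"
      by (intro power_mono norm_triangle_ineq norm_triangle_ineq4 norm_ge_zero)+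
    moreover have "(?a + ?b)\<^sup>2 \<le> 2 * (?a\<^sup>2 + ?b\<^sup>2)"
      using zero_le_power2[of "?a - ?b"] by (simp add: power2_eq_square algebra_simps)
    ultimately show "(norm (f n \<eta> + g n \<eta>))\<^sup>2 + (norm (f n \<eta> - g n \<eta>))\<^sup>2 \<le> 4 * (?a\<^sup>2 + ?b\<^sup>2)"
      by linarith
  qed (use C in simp)
  also have "\<dots> = C * (F + ?E (\<lambda>\<eta>. (norm (g n \<eta>))\<^sup>2))"
    by (simp add: cube_expectation_add cube_expectation_cmult F_def)
  also have "\<dots> \<le> C * (F + \<mu>\<^sup>2 * H)"
    using C g_norm by (intro mult_left_mono) auto
  finally have "H \<le> 16 * C\<^sup>2 * F"
    using C by (simp add: \<mu>_def field_simps power2_eq_square)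
  then show ?thesis unfolding H_def G_def F_def .
qed

section \<open>From the UMD property to delta-convexity\<close>

text \<open>By orthogonality the signed sum is the pairing of the transform with \<open>f n\<close>, to which the
  inequality between geometric and arithmetic mean applies.\<close>

lemma signed_sum_bound_if_transform_bound:
  assumes "\<And>n f \<epsilon>. n \<ge> 1 \<Longrightarrow> adapted_odd n f \<Longrightarrow> (\<And>k. k \<in> {1..n} \<Longrightarrow> \<epsilon> k \<in> signs) \<Longrightarrow>
      cube_expectation n (\<lambda>\<eta>. (norm (\<Sum>k = 1..n. \<epsilon> k *\<^sub>R T (martingale_diff f k \<eta>)))\<^sup>2)
      \<le> C * cube_expectation n (\<lambda>\<eta>. (norm (f n \<eta>))\<^sup>2)"
    and C: "C > 0"
    and f: "adapted_odd n f" and \<epsilon>: "\<And>k. k \<in> {1..n} \<Longrightarrow> \<epsilon> k \<in> signs"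
  shows "(\<Sum>k = 1..n. \<epsilon> k * cube_expectation n (\<lambda>\<eta>. form (martingale_diff f k \<eta>)))
    \<le> (C + 1) / 2 * cube_expectation n (\<lambda>\<eta>. (norm (f n \<eta>))\<^sup>2)"
proof (cases "n \<ge> 1")
  case False
  have "0 \<le> cube_expectation n (\<lambda>\<eta>. (norm (f n \<eta>))\<^sup>2)"
    using cube_expectation_mono[of n "\<lambda>_. 0" "\<lambda>\<eta>. (norm (f n \<eta>))\<^sup>2"] by (simp add: cube_expectation_const)
  then show ?thesis using False C by simp
next
  case True
  let ?E = "cube_expectation n"
  define G where "G \<eta> = (\<Sum>k = 1..n. \<epsilon> k *\<^sub>R T (martingale_diff f k \<eta>))" for \<eta>
  have "(\<Sum>k = 1..n. \<epsilon> k * ?E (\<lambda>\<eta>. form (martingale_diff f k \<eta>)))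
      = (\<Sum>k = 1..n. \<epsilon> k * ?E (\<lambda>\<eta>. T (martingale_diff f k \<eta>) (f n \<eta>)))"
    by (intro sum.cong refl) (simp add: martingale_pairing[OF f f] form_def)
  also have "\<dots> = ?E (\<lambda>\<eta>. G \<eta> (f n \<eta>))"
    unfolding G_def
    by (simp add: blinfun.sum_left blinfun.scaleR_left cube_expectation_sum cube_expectation_cmult)
  also have "\<dots> \<le> ?E (\<lambda>\<eta>. 1/2 * ((norm (G \<eta>))\<^sup>2 + (norm (f n \<eta>))\<^sup>2))"
  proof (rule cube_expectation_mono)
    fix \<eta>
    have "G \<eta> (f n \<eta>) \<le> norm (G \<eta>) * norm (f n \<eta>)"
      using norm_blinfun[of "G \<eta>" "f n \<eta>"] by simp
    also have "\<dots> \<le> 1/2 * ((norm (G \<eta>))\<^sup>2 + (norm (f n \<eta>))\<^sup>2)"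
      using zero_le_power2[of "norm (G \<eta>) - norm (f n \<eta>)"] by (simp add: power2_eq_square algebra_simps)
    finally show "G \<eta> (f n \<eta>) \<le> 1/2 * ((norm (G \<eta>))\<^sup>2 + (norm (f n \<eta>))\<^sup>2)" .
  qed
  also have "\<dots> \<le> (C + 1) / 2 * ?E (\<lambda>\<eta>. (norm (f n \<eta>))\<^sup>2)"
    using assms(1)[OF True f \<epsilon>] unfolding G_def cube_expectation_cmult cube_expectation_add
    by (simp add: field_simps)
  finally show ?thesis .
qed

text \<open>The number \<open>a\<close> is the value of \<open>C E \<bar>f\<^sub>m\<bar>\<^sup>2 - \<Sum>\<^sub>k (-1) ^ (m - k) E (form df\<^sub>k)\<close> for a martingale that starts at
  \<open>x\<close>, built by recursion on its first step, which goes to \<open>x + h\<close> or \<open>x - h\<close>. The sign of a step depends on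
  the number of remaining steps only, because the UMD inequality admits only constant signs. A step with
  \<open>h = 0\<close> costs nothing and shifts this parity, so the sign can be chosen for each step after all.\<close>

inductive zigzag :: "real \<Rightarrow> nat \<Rightarrow> 'a \<Rightarrow> real \<Rightarrow> bool" for C where
  leaf: "zigzag C 0 x (C * (norm x)\<^sup>2)"
| node: "zigzag C m (x + h) a \<Longrightarrow> zigzag C m (x - h) b
    \<Longrightarrow> zigzag C (Suc m) x ((a + b) / 2 - (-1) ^ m * form h)"

lemma zigzag_0D: "zigzag C 0 x a \<Longrightarrow> a = C * (norm x)\<^sup>2"
  by (erule zigzag.cases) auto

lemma zigzag_SucD:
  "zigzag C (Suc m) x a \<Longrightarrow> \<exists>h b c. zigzag C m (x + h) b \<and> zigzag C m (x - h) c
    \<and> a = (b + c) / 2 - (-1) ^ m * form h"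
  by (erule zigzag.cases) auto

lemma zigzag_Suc: "zigzag C m x a \<Longrightarrow> zigzag C (Suc m) x a"
  using zigzag.node[of C m x 0 a a] by (simp add: form_0)

lemma zigzag_le: "m \<le> n \<Longrightarrow> zigzag C m x a \<Longrightarrow> zigzag C n x a"
  by (induction n rule: dec_induct) (auto intro: zigzag_Suc)

text \<open>The tree behind a derivation is run forward as a Markov chain: the state is a point together with its
  value, the next displacement \<open>H\<close> is a function of the state, and the next coordinate of the cube
  selects one of the two children. In this way coordinates are only appended at the end, as the
  filtration requires, although the recursion splits off the first step.\<close>

lemma zigzag_martingale:
  assumes "zigzag C n x a"
  obtains f where "adapted_odd n f"
    "a = C * cube_expectation n (\<lambda>\<eta>. (norm (f n \<eta>))\<^sup>2)
      - (\<Sum>k = 1..n. (-1) ^ (n - k) * cube_expectation n (\<lambda>\<eta>. form (martingale_diff f k \<eta>)))"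
proof -
  let ?E = "cube_expectation n"
  obtain H L R where HLR: "\<And>m y b. zigzag C (Suc m) y b \<Longrightarrow>
      zigzag C m (y + H m y b) (L m y b) \<and> zigzag C m (y - H m y b) (R m y b)
      \<and> b = (L m y b + R m y b) / 2 - (-1) ^ m * form (H m y b)"
    using zigzag_SucD[of C] by metis
  define Z where "Z \<eta> = rec_nat (x, a) (\<lambda>k (y, b).
      (y + \<eta> (Suc k) *\<^sub>R H (n - Suc k) y b,
       if \<eta> (Suc k) = 1 then L (n - Suc k) y b else R (n - Suc k) y b))" for \<eta> :: "nat \<Rightarrow> real"
  define f where "f k \<eta> = fst (Z \<eta> k)" for k \<eta>
  define b where "b k \<eta> = snd (Z \<eta> k)" for k \<eta>
  have f_0: "f 0 \<eta> = x" and b_0: "b 0 \<eta> = a" for \<eta>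
    by (simp_all add: f_def b_def Z_def)
  have f_Suc: "f (Suc k) \<eta> = f k \<eta> + \<eta> (Suc k) *\<^sub>R H (n - Suc k) (f k \<eta>) (b k \<eta>)"
    and b_Suc: "b (Suc k) \<eta> = (if \<eta> (Suc k) = 1 then L (n - Suc k) (f k \<eta>) (b k \<eta>)
      else R (n - Suc k) (f k \<eta>) (b k \<eta>))" for k \<eta>
    by (simp_all add: f_def b_def Z_def split_beta)
  have zz: "zigzag C (n - k) (f k \<eta>) (b k \<eta>)" if "k \<le> n" "\<eta> \<in> sign_cube n" for k \<eta>
    using that
  proof (induction k)
    case 0
    then show ?case using assms by (simp add: f_0 b_0)
  next
    case (Suc k)
    have "n - k = Suc (n - Suc k)" using Suc.prems by simp
    then have "zigzag C (Suc (n - Suc k)) (f k \<eta>) (b k \<eta>)" using Suc by simp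
    then show ?case
      using HLR[of "n - Suc k" "f k \<eta>" "b k \<eta>"] sign_cube_apply[OF Suc.prems(2), of "Suc k"] Suc.prems(1)
      unfolding f_Suc b_Suc by auto
  qed
  have dep_fb: "f k \<eta> = f k \<eta>' \<and> b k \<eta> = b k \<eta>'" if "\<And>i. i \<in> {1..k} \<Longrightarrow> \<eta> i = \<eta>' i" for k \<eta> \<eta>'
    using that
  proof (induction k)
    case (Suc k)
    have "\<eta> (Suc k) = \<eta>' (Suc k)" "f k \<eta> = f k \<eta>' \<and> b k \<eta> = b k \<eta>'"
      using Suc.prems Suc.IH by auto
    then show ?case unfolding f_Suc b_Suc by simp
  qed (simp add: f_0 b_0)
  have fb_flip: "f k (flip (Suc k) \<eta>) = f k \<eta>" "b k (flip (Suc k) \<eta>) = b k \<eta>" for k \<eta>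
    using dep_fb[of k "flip (Suc k) \<eta>" \<eta>] by (auto simp: flip_def)
  have diff: "martingale_diff f (Suc k) \<eta> = \<eta> (Suc k) *\<^sub>R H (n - Suc k) (f k \<eta>) (b k \<eta>)" for k \<eta>
    by (simp add: martingale_diff_def f_Suc)
  have f: "adapted_odd n f"
    unfolding adapted_odd_def
  proof (intro conjI allI impI ballI)
    show "depends_on_first n k (f k)" for k
      by (rule depends_on_firstI) (use dep_fb in blast)
    fix k \<eta> assume "k \<in> {1..n}"
    then obtain j where "k = Suc j" by (cases k) auto
    then show "martingale_diff f k (flip k \<eta>) = - martingale_diff f k \<eta>"
      by (simp add: diff fb_flip flip_same)
  qed
  have step: "?E (b (Suc k)) = ?E (b k) + (-1) ^ (n - Suc k) * ?E (\<lambda>\<eta>. form (martingale_diff f (Suc k) \<eta>))"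
    if k: "Suc k \<le> n" for k
  proof -
    have k': "Suc k \<in> {1..n}" using k by simp
    have "1/2 * (b (Suc k) \<eta> + b (Suc k) (flip (Suc k) \<eta>))
        = b k \<eta> + (-1) ^ (n - Suc k) * form (martingale_diff f (Suc k) \<eta>)"
      if \<eta>: "\<eta> \<in> sign_cube n" for \<eta>
    proof -
      let ?H = "H (n - Suc k) (f k \<eta>) (b k \<eta>)"
      have sgn: "\<eta> (Suc k) = -1 \<or> \<eta> (Suc k) = 1" by (rule sign_cube_apply[OF \<eta> k'])
      have "zigzag C (Suc (n - Suc k)) (f k \<eta>) (b k \<eta>)"
        using zz[of k \<eta>] \<eta> k by (simp add: Suc_diff_Suc)
      note b_k = HLR[OF this, THEN conjunct2, THEN conjunct2]
      have form_d: "form (martingale_diff f (Suc k) \<eta>) = form ?H"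
        using sgn by (auto simp: diff form_minus)
      have b_sum: "b (Suc k) \<eta> + b (Suc k) (flip (Suc k) \<eta>)
          = L (n - Suc k) (f k \<eta>) (b k \<eta>) + R (n - Suc k) (f k \<eta>) (b k \<eta>)"
        using sgn by (auto simp: b_Suc fb_flip flip_same)
      show ?thesis unfolding form_d b_sum using b_k by linarith
    qed
    then have "?E (\<lambda>\<eta>. 1/2 * (b (Suc k) \<eta> + b (Suc k) (flip (Suc k) \<eta>)))
        = ?E (\<lambda>\<eta>. b k \<eta> + (-1) ^ (n - Suc k) * form (martingale_diff f (Suc k) \<eta>))"
      by (rule cube_expectation_cong)
    then show ?thesis
      unfolding cube_expectation_cmult cube_expectation_add cube_expectation_flip[OF k'] by simp
  qed
  have "?E (b m) - a = (\<Sum>k = 1..m. (-1) ^ (n - k) * ?E (\<lambda>\<eta>. form (martingale_diff f k \<eta>)))"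
    if "m \<le> n" for m
    using that
  proof (induction m)
    case 0
    have "b 0 = (\<lambda>\<eta>. a)" by (simp add: fun_eq_iff b_0)
    then show ?case by (simp add: cube_expectation_const)
  next
    case (Suc m)
    then show ?case using step[of m] by simp
  qed
  from this[of n] have "a = ?E (b n) - (\<Sum>k = 1..n. (-1) ^ (n - k) * ?E (\<lambda>\<eta>. form (martingale_diff f k \<eta>)))"
    by simp
  moreover have "?E (b n) = C * ?E (\<lambda>\<eta>. (norm (f n \<eta>))\<^sup>2)"
    unfolding cube_expectation_cmult[symmetric]
    using zz[of n] by (intro cube_expectation_cong zigzag_0D) simp
  ultimately show ?thesis using that[OF f] by simp
qed

text \<open>The infimum \<open>V\<close> of all values is finite by the hypothesis, at most \<open>C * (norm x)\<^sup>2\<close> by the trivial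
  martingale, and gains at least \<open>\<bar>form h\<bar>\<close> when averaged over \<open>x + h\<close> and \<open>x - h\<close>. This is exactly what
  makes \<open>V + form\<close> and \<open>V - form\<close> midpoint convex.\<close>

lemma delta_convex_if_signed_sum_bound:
  assumes C: "C > 0" and bound: "\<And>n f \<epsilon>. adapted_odd n f \<Longrightarrow> (\<And>k. k \<in> {1..n} \<Longrightarrow> \<epsilon> k \<in> signs) \<Longrightarrow>
      (\<Sum>k = 1..n. \<epsilon> k * cube_expectation n (\<lambda>\<eta>. form (martingale_diff f k \<eta>)))
      \<le> C * cube_expectation n (\<lambda>\<eta>. (norm (f n \<eta>))\<^sup>2)"
  shows "delta_convex form"
proof -
  have nonneg: "0 \<le> a" if zz: "zigzag C n x a" for n x a
  proof -
    obtain f where f: "adapted_odd n f" "a = C * cube_expectation n (\<lambda>\<eta>. (norm (f n \<eta>))\<^sup>2)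
        - (\<Sum>k = 1..n. (-1) ^ (n - k) * cube_expectation n (\<lambda>\<eta>. form (martingale_diff f k \<eta>)))"
      using zigzag_martingale[OF zz] .
    show ?thesis
      using bound[OF f(1), of "\<lambda>k. (-1) ^ (n - k)"] unfolding f(2)
      by (simp add: signs_def minus_one_power_iff)
  qed
  define V where "V x = Inf {a. \<exists>n. zigzag C n x a}" for x
  have bdd: "bdd_below {a. \<exists>n. zigzag C n x a}" for x
    using nonneg by (intro bdd_belowI[of _ 0]) auto
  have V_le: "V x \<le> a" if "zigzag C n x a" for n x a
    unfolding V_def using that by (intro cInf_lower bdd) auto
  have V_approx: "\<exists>n a. zigzag C n x a \<and> a < V x + e" if "e > 0" for x e
  proof -
    have "zigzag C 0 x (C * (norm x)\<^sup>2)" by (rule leaf)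
    then have "{a. \<exists>n. zigzag C n x a} \<noteq> {}" by blast
    from cInf_lessD[OF this, of "V x + e"] that show ?thesis unfolding V_def by auto
  qed
  have V_nonneg: "0 \<le> V x" for x
    unfolding V_def using leaf nonneg by (intro cInf_greatest) auto
  have V_upper: "V x \<le> C * (norm x)\<^sup>2" for x
    by (rule V_le[OF leaf])
  have V_mid: "V x \<le> (V (x + h) + V (x - h)) / 2 - \<bar>form h\<bar>" for x h
  proof (rule field_le_epsilon)
    fix e :: real assume e: "e > 0"
    obtain n1 a1 n2 a2 where a: "zigzag C n1 (x + h) a1" "a1 < V (x + h) + e"
      "zigzag C n2 (x - h) a2" "a2 < V (x - h) + e"
      using V_approx[OF e] by metis
    \<comment> \<open>padding allows either parity, hence either sign of the new term\<close>
    define m where "m = (if even (max n1 n2) = (form h \<ge> 0) then max n1 n2 else Suc (max n1 n2))"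
    have "n1 \<le> m" "n2 \<le> m" and sgn: "(-1) ^ m * form h = \<bar>form h\<bar>"
      by (auto simp: m_def minus_one_power_iff max_def)
    then have "zigzag C (Suc m) x ((a1 + a2) / 2 - (-1) ^ m * form h)"
      using a by (intro node) (auto intro: zigzag_le)
    then have "V x \<le> (a1 + a2) / 2 - \<bar>form h\<bar>" unfolding sgn by (rule V_le)
    then show "V x \<le> (V (x + h) + V (x - h)) / 2 - \<bar>form h\<bar> + e" using a by (simp add: field_simps)
  qed
  have main: "convex_on UNIV (\<lambda>x. V x + \<sigma> * form x) \<and> continuous_on UNIV (\<lambda>x. V x + \<sigma> * form x)"
    if \<sigma>: "\<bar>\<sigma>\<bar> = 1" for \<sigma>
  proof -
    have abs_le: "\<bar>V x + \<sigma> * form x\<bar> \<le> (C + norm T) * r\<^sup>2" if r: "norm x \<le> r" for x r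
    proof -
      have "\<bar>V x + \<sigma> * form x\<bar> \<le> \<bar>V x\<bar> + \<bar>form x\<bar>"
        using \<sigma> by (intro order_trans[OF abs_triangle_ineq]) (simp add: abs_mult)
      also have "\<dots> \<le> (C + norm T) * (norm x)\<^sup>2"
        using V_nonneg[of x] V_upper[of x] abs_form_le[of x] by (simp add: distrib_right)
      also have "\<dots> \<le> (C + norm T) * r\<^sup>2"
        using r C by (intro mult_left_mono power_mono) auto
      finally show ?thesis .
    qed
    have "convex_on UNIV (\<lambda>x. V x + \<sigma> * form x)"
    proof (rule convex_on_if_midpoint_convex)
      fix x h
      have "\<sigma> = 1 \<or> \<sigma> = -1" using \<sigma> by auto
      then show "2 * (V x + \<sigma> * form x) \<le> V (x + h) + \<sigma> * form (x + h) + (V (x - h) + \<sigma> * form (x - h))"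
        using V_mid[of x h] form_parallelogram[of x h] by (auto simp: field_simps)
    next
      show "\<exists>B. \<forall>x. norm x \<le> r \<longrightarrow> V x + \<sigma> * form x \<le> B" for r
        using abs_le abs_le_D1 by blast
    qed
    moreover from this have "continuous_on UNIV (\<lambda>x. V x + \<sigma> * form x)"
      by (rule continuous_on_if_convex_bounded_on_balls) (use abs_le in blast)
    ultimately show ?thesis by simp
  qed
  show ?thesis
    unfolding delta_convex_def
  proof (intro exI conjI allI)
    show "convex_on UNIV (\<lambda>x. 1/2 * (V x + 1 * form x))" "convex_on UNIV (\<lambda>x. 1/2 * (V x + (-1) * form x))"
      using main[of 1] main[of "-1"] by (intro convex_on_cmul; simp)+
    show "continuous_on UNIV (\<lambda>x. 1/2 * (V x + 1 * form x))" "continuous_on UNIV (\<lambda>x. 1/2 * (V x + (-1) * form x))"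
      using main[of 1] main[of "-1"] by (intro continuous_on_mult_left; simp)+
    show "form x = 1/2 * (V x + 1 * form x) - 1/2 * (V x + (-1) * form x)" for x by (simp add: field_simps)
  qed
qed

end

theorem theorem2p12:
  fixes q :: "'a::banach \<Rightarrow> real"
    and T :: "'a \<Rightarrow>\<^sub>L ('a \<Rightarrow>\<^sub>L real)"
  assumes "continuous_quadratic_form q"
    and "symmetric_operator T"
    and "\<And>x. q x = blinfun_apply (blinfun_apply T x) x"
  shows "delta_convex q \<longleftrightarrow> UMD_operator (blinfun_apply T)"
proof -
  interpret symmetric_form T
    by unfold_locales (use assms(2) in \<open>simp add: symmetric_operator_def\<close>)
  have q: "q = form" by (rule ext) (simp add: form_def assms(3))
  show ?thesis
  proof
    assume "delta_convex q"
    then obtain C where C: "C > 0" "\<And>n f. adapted_odd n f \<Longrightarrow>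
        (\<Sum>k = 1..n. cube_expectation n (\<lambda>\<eta>. \<bar>form (martingale_diff f k \<eta>)\<bar>))
        \<le> C * cube_expectation n (\<lambda>\<eta>. (norm (f n \<eta>))\<^sup>2)"
      using square_estimate_if_delta_convex unfolding q by blast
    have "linear (blinfun_apply T)"
      by (rule bounded_linear.linear[OF blinfun.bounded_linear_right])
    moreover have "16 * C\<^sup>2 > 0" using C(1) by simp
    ultimately show "UMD_operator (blinfun_apply T)"
      unfolding UMD_operator_def walsh_paley_martingale_iff
      using transform_bound_if_square_estimate[OF C] by blast
  next
    assume "UMD_operator (blinfun_apply T)"
    then obtain C where C: "C > 0" "\<And>n f \<epsilon>. n \<ge> 1 \<Longrightarrow> adapted_odd n f \<Longrightarrow>
        (\<And>k. k \<in> {1..n} \<Longrightarrow> \<epsilon> k \<in> signs) \<Longrightarrow>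
        cube_expectation n (\<lambda>\<eta>. (norm (\<Sum>k = 1..n. \<epsilon> k *\<^sub>R T (martingale_diff f k \<eta>)))\<^sup>2)
        \<le> C * cube_expectation n (\<lambda>\<eta>. (norm (f n \<eta>))\<^sup>2)"
      unfolding UMD_operator_def walsh_paley_martingale_iff by blast
    show "delta_convex q"
      unfolding q
      by (rule delta_convex_if_signed_sum_bound[of "(C + 1) / 2"])
        (use C signed_sum_bound_if_transform_bound[OF C(2) C(1)] in auto)
  qed
qed

end
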